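(* For every $2\le p<\infty$, the pair $(\ell_p, L_p[0,1])$ has property $(m)$, and it has the weak minimizing property.
   Context: For Banach spaces $X,Y$, $\mathcal{L}(X,Y)$ denotes the space of bounded linear operators from $X$ to $Y$, and $S_X$ the unit sphere of $X$. The minimum modulus of $T\in\mathcal{L}(X,Y)$ is $m(T)=\inf\{\|Tx\|:x\in S_X\}$; $T$ attains its minimum modulus if $\|Tx\|=m(T)$ for some $x\in S_X$. A minimizing sequence for $T$ is a sequence $(x_n)_n$ in $S_X$ with $\|Tx_n\|\to m(T)$. The pair $(X,Y)$ has the weak minimizing property (WmP) if every $T\in\mathcal{L}(X,Y)$ that admits a non-weakly null minimizing sequence (i.e. one that does not converge weakly to $0$) attains its minimum modulus. An operator $T\in\mathcal{L}(X,Y)$ satisfies property $(m)$ if for all $x\in X$, $y\in Y$ with $\|x\|\le\|y\|$ and every weakly null sequence $(x_n)_n$ in $X$, $\limsup_n\|x+x_n\|\le\limsup_n\|y+Tx_n\|$. The pair $(X,Y)$ has property $(m)$ if every $T\in\mathcal{L}(X,Y)$ with $m(T)\ge 1$ satisfies property $(m)$. *)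

theory Defs
  imports "HOL-Analysis.Analysis"
begin

text \<open>
  Since \<open>p\<close> is a variable, the spaces \<open>\<ell>\<^sub>p\<close> and \<open>L\<^sub>p[0,1]\<close> cannot be types; normed spaces are
  records with an explicit carrier. The scalar field \<open>'k\<close> is meant to be \<^typ>\<open>real\<close> or
  \<^typ>\<open>complex\<close>. Maps between spaces are HOL functions of which only the values on the carrier
  are ever used.
\<close>

record ('k, 'v) normed_sp =
  carrier :: "'v set"
  vadd :: "'v \<Rightarrow> 'v \<Rightarrow> 'v"
  vscale :: "'k \<Rightarrow> 'v \<Rightarrow> 'v"
  vnorm :: "'v \<Rightarrow> real"

definition sphere_of :: "('k, 'v) normed_sp \<Rightarrow> 'v set" where
  "sphere_of X = {x \<in> carrier X. vnorm X x = 1}"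

definition bounded_ops :: "('k, 'v) normed_sp \<Rightarrow> ('k, 'w) normed_sp \<Rightarrow> ('v \<Rightarrow> 'w) set" where
  "bounded_ops X Y = {T.
     (\<forall>x\<in>carrier X. T x \<in> carrier Y) \<and>
     (\<forall>x\<in>carrier X. \<forall>x'\<in>carrier X. T (vadd X x x') = vadd Y (T x) (T x')) \<and>
     (\<forall>c. \<forall>x\<in>carrier X. T (vscale X c x) = vscale Y c (T x)) \<and>
     (\<exists>C. \<forall>x\<in>carrier X. vnorm Y (T x) \<le> C * vnorm X x)}"

definition scalar_sp :: "('k::real_normed_field, 'k) normed_sp" where
  "scalar_sp = \<lparr>carrier = UNIV, vadd = (+), vscale = (*), vnorm = norm\<rparr>"

definition weakly_null :: "('k::real_normed_field, 'v) normed_sp \<Rightarrow> (nat \<Rightarrow> 'v) \<Rightarrow> bool" where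
  "weakly_null X xs \<longleftrightarrow>
     (\<forall>n. xs n \<in> carrier X) \<and>
     (\<forall>f\<in>bounded_ops X scalar_sp. (\<lambda>n. f (xs n)) \<longlonglongrightarrow> 0)"

definition min_modulus :: "('k, 'v) normed_sp \<Rightarrow> ('k, 'w) normed_sp \<Rightarrow> ('v \<Rightarrow> 'w) \<Rightarrow> real" where
  "min_modulus X Y T = (INF x\<in>sphere_of X. vnorm Y (T x))"

definition attains_min_modulus ::
    "('k, 'v) normed_sp \<Rightarrow> ('k, 'w) normed_sp \<Rightarrow> ('v \<Rightarrow> 'w) \<Rightarrow> bool" where
  "attains_min_modulus X Y T \<longleftrightarrow> (\<exists>x\<in>sphere_of X. vnorm Y (T x) = min_modulus X Y T)"

definition minimizing_seq ::
    "('k, 'v) normed_sp \<Rightarrow> ('k, 'w) normed_sp \<Rightarrow> ('v \<Rightarrow> 'w) \<Rightarrow> (nat \<Rightarrow> 'v) \<Rightarrow> bool" where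
  "minimizing_seq X Y T xs \<longleftrightarrow>
     (\<forall>n. xs n \<in> sphere_of X) \<and> (\<lambda>n. vnorm Y (T (xs n))) \<longlonglongrightarrow> min_modulus X Y T"

definition weak_minimizing_property ::
    "('k::real_normed_field, 'v) normed_sp \<Rightarrow> ('k, 'w) normed_sp \<Rightarrow> bool" where
  "weak_minimizing_property X Y \<longleftrightarrow>
     (\<forall>T\<in>bounded_ops X Y.
        (\<exists>xs. minimizing_seq X Y T xs \<and> \<not> weakly_null X xs) \<longrightarrow> attains_min_modulus X Y T)"

definition op_property_m ::
    "('k::real_normed_field, 'v) normed_sp \<Rightarrow> ('k, 'w) normed_sp \<Rightarrow> ('v \<Rightarrow> 'w) \<Rightarrow> bool" where
  "op_property_m X Y T \<longleftrightarrow>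
     (\<forall>x\<in>carrier X. \<forall>y\<in>carrier Y. vnorm X x \<le> vnorm Y y \<longrightarrow>
        (\<forall>xs. weakly_null X xs \<longrightarrow>
           limsup (\<lambda>n. ereal (vnorm X (vadd X x (xs n))))
             \<le> limsup (\<lambda>n. ereal (vnorm Y (vadd Y y (T (xs n)))))))"

definition pair_property_m ::
    "('k::real_normed_field, 'v) normed_sp \<Rightarrow> ('k, 'w) normed_sp \<Rightarrow> bool" where
  "pair_property_m X Y \<longleftrightarrow>
     (\<forall>T\<in>bounded_ops X Y. min_modulus X Y T \<ge> 1 \<longrightarrow> op_property_m X Y T)"

definition lp_space :: "real \<Rightarrow> ('k::real_normed_field, nat \<Rightarrow> 'k) normed_sp" where
  "lp_space p =
     \<lparr>carrier = {x. summable (\<lambda>n. norm (x n) powr p)},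
      vadd = (\<lambda>x y n. x n + y n),
      vscale = (\<lambda>c x n. c * x n),
      vnorm = (\<lambda>x. (\<Sum>n. norm (x n) powr p) powr (1 / p))\<rparr>"

text \<open>
  The elements of \<open>L\<^sub>p(M)\<close> are the classes, modulo equality almost everywhere, of measurable
  functions with integrable \<open>p\<close>-th power.
\<close>

definition Lp_fun :: "'a measure \<Rightarrow> real \<Rightarrow> ('a \<Rightarrow> 'k::real_normed_field) set" where
  "Lp_fun M p = {f \<in> borel_measurable M. integrable M (\<lambda>t. norm (f t) powr p)}"

definition Lp_class :: "'a measure \<Rightarrow> real \<Rightarrow> ('a \<Rightarrow> 'k::real_normed_field) \<Rightarrow> ('a \<Rightarrow> 'k) set" where
  "Lp_class M p f = {g \<in> Lp_fun M p. AE t in M. g t = f t}"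

definition Lp_space :: "'a measure \<Rightarrow> real \<Rightarrow> ('k::real_normed_field, ('a \<Rightarrow> 'k) set) normed_sp" where
  "Lp_space M p =
     \<lparr>carrier = Lp_class M p ` Lp_fun M p,
      vadd = (\<lambda>A B. \<Union>f\<in>A. \<Union>g\<in>B. Lp_class M p (\<lambda>t. f t + g t)),
      vscale = (\<lambda>c A. \<Union>f\<in>A. Lp_class M p (\<lambda>t. c * f t)),
      vnorm = (\<lambda>A. the_elem ((\<lambda>f. (\<integral>t. norm (f t) powr p \<partial>M) powr (1 / p)) ` A))\<rparr>"

abbreviation Lp01 :: "real \<Rightarrow> ('k::real_normed_field, (real \<Rightarrow> 'k) set) normed_sp" where
  "Lp01 p \<equiv> Lp_space (lebesgue_on {0..1}) p"

end

theory Submission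
  imports Defs "HOL-Real_Asymp.Real_Asymp"
begin

text \<open>
  Let \<open>T\<close> be a bounded operator from \<open>\<ell>\<^sub>p\<close> to \<open>L\<^sub>p\<close> and let \<open>(x\<^sub>n)\<close> be bounded and
  coordinatewise null. The point is that the norms split asymptotically:
  \<open>\<parallel>s + x\<^sub>n\<parallel>\<^sup>p - \<parallel>x\<^sub>n\<parallel>\<^sup>p\<close> tends to \<open>\<parallel>s\<parallel>\<^sup>p\<close> in \<open>\<ell>\<^sub>p\<close>, and
  \<open>\<parallel>y + T x\<^sub>n\<parallel>\<^sup>p - \<parallel>T x\<^sub>n\<parallel>\<^sup>p\<close> tends to \<open>\<parallel>y\<parallel>\<^sup>p\<close> in \<open>L\<^sub>p\<close>. The first is the Brezis-Lieb
  lemma for the counting measure. The second is the Brezis-Lieb lemma again when \<open>p > 2\<close>, because then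
  \<open>T x\<^sub>n\<close> tends to \<open>0\<close> in \<open>L\<^sub>2\<close>: otherwise suitable signed sums of \<open>k\<close> of the \<open>x\<^sub>n\<close> would have
  norm of order at most \<open>k\<^sup>1\<^sup>/\<^sup>p\<close>, but images of \<open>L\<^sub>2\<close> norm of order at least \<open>k\<^sup>1\<^sup>/\<^sup>2\<close>.
  For \<open>p = 2\<close> it is the weak convergence of \<open>T x\<^sub>n\<close> to \<open>0\<close>.

  Property \<open>(m)\<close> follows by comparing the two splittings. For the weak minimizing property, a
  subsequence of a non-weakly null minimizing sequence has the form \<open>s + w\<^sub>n\<close> with \<open>s \<noteq> 0\<close> and \<open>(w\<^sub>n)\<close>
  coordinatewise null, and the splittings give \<open>\<parallel>T s\<parallel>\<^sup>p \<le> m(T)\<^sup>p \<parallel>s\<parallel>\<^sup>p\<close>.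
\<close>

section \<open>Estimates for p-th powers of norms\<close>

lemma powr_add_le:
  fixes a b p :: real
  assumes "0 \<le> a" "0 \<le> b" "0 \<le> p"
  shows "(a + b) powr p \<le> 2 powr p * (a powr p + b powr p)"
proof -
  have "(a + b) powr p \<le> (2 * max a b) powr p"
    using assms by (intro powr_mono2) auto
  also have "\<dots> = 2 powr p * (max a b) powr p"
    using assms by (simp add: powr_mult)
  also have "\<dots> \<le> 2 powr p * (a powr p + b powr p)"
    by (intro mult_left_mono) (auto simp: max_def)
  finally show ?thesis .
qed

lemma norm_add_powr_le:
  fixes a b :: "'k::real_normed_vector"
  assumes "0 \<le> p"
  shows "norm (a + b) powr p \<le> 2 powr p * (norm a powr p + norm b powr p)"
proof -
  have "norm (a + b) powr p \<le> (norm a + norm b) powr p"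
    using assms by (intro powr_mono2) (auto intro: norm_triangle_ineq)
  also have "\<dots> \<le> 2 powr p * (norm a powr p + norm b powr p)"
    using assms by (intro powr_add_le) auto
  finally show ?thesis .
qed

text \<open>The pointwise estimate behind the Brezis-Lieb lemma. If \<open>a\<close> is small
  relative to \<open>b\<close>, continuity of the p-th power at 1 makes the relative error at most
  \<open>e\<close>; otherwise \<open>b\<close> and \<open>a + b\<close> are both bounded by a
  multiple of \<open>a\<close>, which the constant \<open>C\<close> absorbs.\<close>

lemma powr_perturbation:
  fixes p e :: real
  assumes "0 < p" "0 < e"
  obtains C where "0 \<le> C"
    "\<And>a b :: 'k::real_normed_vector.
       \<bar>norm (a + b) powr p - norm b powr p\<bar> \<le> e * norm b powr p + C * norm a powr p"
proof -
  have 1: "((\<lambda>h. (1 + h) powr p) \<longlongrightarrow> 1) (at_right 0)"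
    and 2: "((\<lambda>h. (1 - h) powr p) \<longlongrightarrow> 1) (at_right 0)"
    by (auto intro!: tendsto_eq_intros)
  have "\<forall>\<^sub>F h in at_right 0. (1 + h) powr p < 1 + e"
    using order_tendstoD(2)[OF 1, of "1 + e"] assms by auto
  moreover have "\<forall>\<^sub>F h in at_right 0. (1 - h) powr p > 1 - e"
    using order_tendstoD(1)[OF 2, of "1 - e"] assms by auto
  moreover have "\<forall>\<^sub>F h in at_right (0::real). 0 < h \<and> h < 1"
    unfolding eventually_at_right_field by (intro exI[of _ 1]) auto
  ultimately have "\<forall>\<^sub>F h in at_right 0. (1 + h) powr p < 1 + e \<and> (1 - h) powr p > 1 - e \<and> 0 < h \<and> h < 1"
    by eventually_elim auto
  \<comment> \<open>The threshold \<open>h\<close> separates the two regimes: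
    \<open>norm a < h * norm b\<close> and its negation.\<close>
  then obtain h where h: "(1 + h) powr p < 1 + e" "(1 - h) powr p > 1 - e" "0 < h" "h < 1"
    using eventually_happens'[OF trivial_limit_at_right_real] by blast
  have "\<bar>norm (a + b) powr p - norm b powr p\<bar> \<le> e * norm b powr p + (1 + 1 / h) powr p * norm a powr p"
    for a b :: 'k
  proof (cases "norm a < h * norm b")
    case True
    have "norm (a + b) powr p \<le> ((1 + h) * norm b) powr p"
      using assms True norm_triangle_ineq[of a b] by (intro powr_mono2) (auto simp: algebra_simps)
    also have "\<dots> \<le> (1 + e) * norm b powr p"
      using h by (simp add: powr_mult mult_right_mono)
    finally have u: "norm (a + b) powr p \<le> (1 + e) * norm b powr p" .
    have "(1 - e) * norm b powr p \<le> ((1 - h) * norm b) powr p"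
      using h by (simp add: powr_mult mult_right_mono)
    also have "norm b \<le> norm (a + b) + norm a"
      using norm_triangle_ineq4[of "a + b" a] by simp
    then have "((1 - h) * norm b) powr p \<le> norm (a + b) powr p"
      using assms True h mult_left_le_one_le[of "norm b" h]
      by (intro powr_mono2) (auto simp: left_diff_distrib)
    finally have l: "(1 - e) * norm b powr p \<le> norm (a + b) powr p" .
    have "0 \<le> (1 + 1 / h) powr p * norm a powr p" by simp
    then show ?thesis
      using u l unfolding distrib_right left_diff_distrib by linarith
  next
    case False
    have "norm b \<le> norm a / h" using False h by (simp add: field_simps)
    then have b: "norm b \<le> (1 + 1 / h) * norm a" "norm (a + b) \<le> (1 + 1 / h) * norm a"
      using norm_triangle_ineq[of a b] by (auto simp: algebra_simps intro: order_trans)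
    have "norm b powr p \<le> (1 + 1 / h) powr p * norm a powr p"
      "norm (a + b) powr p \<le> (1 + 1 / h) powr p * norm a powr p"
      using powr_mono2[OF _ _ b(1), of p] powr_mono2[OF _ _ b(2), of p] assms h
      by (auto simp: powr_mult)
    moreover have "0 \<le> e * norm b powr p" "0 \<le> norm b powr p" "0 \<le> norm (a + b) powr p"
      using assms by auto
    ultimately show ?thesis
      by linarith
  qed
  then show ?thesis using that[of "(1 + 1 / h) powr p"] by auto
qed

section \<open>Integrals of p-th powers and the Brezis-Lieb lemma\<close>

text \<open>The p-th power of the norm, on functions rather than classes. This is the quantity that
  splits additively, so roots are taken only when passing back to \<open>vnorm\<close>.\<close>

definition pint :: "'a measure \<Rightarrow> real \<Rightarrow> ('a \<Rightarrow> 'k::real_normed_field) \<Rightarrow> real" where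
  "pint M p f = (\<integral>t. norm (f t) powr p \<partial>M)"

lemma pint_nonneg: "0 \<le> pint M p f"
  by (simp add: pint_def)

lemma Lp_fun_measurable: "f \<in> Lp_fun M p \<Longrightarrow> f \<in> borel_measurable M"
  and Lp_fun_integrable: "f \<in> Lp_fun M p \<Longrightarrow> integrable M (\<lambda>t. norm (f t) powr p)"
  by (auto simp: Lp_fun_def)

lemma Lp_fun_add:
  fixes f g :: "'a \<Rightarrow> 'k::{real_normed_field,euclidean_space}"
  assumes "f \<in> Lp_fun M p" "g \<in> Lp_fun M p" "0 \<le> p"
  shows "(\<lambda>t. f t + g t) \<in> Lp_fun M p"
proof -
  note [measurable] = assms(1,2)[THEN Lp_fun_measurable]
  have "integrable M (\<lambda>t. norm (f t + g t) powr p)"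
  proof (rule Bochner_Integration.integrable_bound)
    show "integrable M (\<lambda>t. 2 powr p * (norm (f t) powr p + norm (g t) powr p))"
      using assms(1,2)[THEN Lp_fun_integrable] by auto
    show "AE t in M. norm (norm (f t + g t) powr p)
        \<le> norm (2 powr p * (norm (f t) powr p + norm (g t) powr p))"
      using norm_add_powr_le[OF assms(3)] by (auto simp: abs_of_nonneg)
  qed measurable
  then show ?thesis by (simp add: Lp_fun_def)
qed

lemma pint_add_le:
  fixes f g :: "'a \<Rightarrow> 'k::{real_normed_field,euclidean_space}"
  assumes "f \<in> Lp_fun M p" "g \<in> Lp_fun M p" "0 \<le> p"
  shows "pint M p (\<lambda>t. f t + g t) \<le> 2 powr p * (pint M p f + pint M p g)"
proof -
  have "pint M p (\<lambda>t. f t + g t) \<le> (\<integral>t. 2 powr p * (norm (f t) powr p + norm (g t) powr p) \<partial>M)"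
    unfolding pint_def
    using assms(1,2)[THEN Lp_fun_integrable] Lp_fun_integrable[OF Lp_fun_add[OF assms]]
      norm_add_powr_le[OF assms(3)]
    by (intro integral_mono) auto
  also have "\<dots> = 2 powr p * (pint M p f + pint M p g)"
    using assms(1,2)[THEN Lp_fun_integrable] by (simp add: pint_def)
  finally show ?thesis .
qed

lemma Lp_fun_scale:
  fixes f :: "'a \<Rightarrow> 'k::{real_normed_field,euclidean_space}"
  assumes "f \<in> Lp_fun M p"
  shows "(\<lambda>t. c * f t) \<in> Lp_fun M p"
  using assms by (auto simp: Lp_fun_def norm_mult powr_mult)

lemma pint_scale:
  fixes f :: "'a \<Rightarrow> 'k::{real_normed_field,euclidean_space}"
  shows "pint M p (\<lambda>t. c * f t) = norm c powr p * pint M p f"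
  by (simp add: pint_def norm_mult powr_mult)

lemma pint_cong_AE:
  fixes f g :: "'a \<Rightarrow> 'k::{real_normed_field,euclidean_space}"
  assumes "f \<in> borel_measurable M" "g \<in> borel_measurable M" "AE t in M. f t = g t"
  shows "pint M p f = pint M p g"
  unfolding pint_def using assms by (intro integral_cong_AE) auto

text \<open>The splitting error \<open>D n\<close> tends to 0 pointwise, but only its excess over
  \<open>e * norm (h n t) powr p\<close> has a fixed integrable majorant. Dominated convergence
  disposes of the excess, and the rest integrates to at most \<open>e * K\<close>.\<close>

lemma brezis_lieb_AE:
  fixes f :: "'a \<Rightarrow> 'k::{real_normed_field,euclidean_space}"
  assumes p: "0 < p" and f: "f \<in> Lp_fun M p" and h: "\<And>n. h n \<in> Lp_fun M p"
    and K: "\<And>n. pint M p (h n) \<le> K"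
    and lim: "AE t in M. (\<lambda>n. h n t) \<longlonglongrightarrow> 0"
  shows "(\<lambda>n. pint M p (\<lambda>t. f t + h n t) - pint M p (h n)) \<longlonglongrightarrow> pint M p f"
proof -
  define D where "D n t = norm (f t + h n t) powr p - norm (h n t) powr p - norm (f t) powr p" for n t
  note [measurable] = f[THEN Lp_fun_measurable] h[THEN Lp_fun_measurable]
  note [simp] = f[THEN Lp_fun_integrable] h[THEN Lp_fun_integrable]
    Lp_fun_integrable[OF Lp_fun_add[OF f h order_less_imp_le[OF p]]]
  have D_int [simp]: "integrable M (D n)" for n
    unfolding D_def by auto
  have D_eq: "(\<integral>t. D n t \<partial>M) = pint M p (\<lambda>t. f t + h n t) - pint M p (h n) - pint M p f" for n
    unfolding D_def pint_def by simp
  have K0: "0 \<le> K" using pint_nonneg[of M p "h 0"] K[of 0] by linarith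
  have "(\<lambda>n. \<integral>t. D n t \<partial>M) \<longlonglongrightarrow> 0"
  proof (rule LIMSEQ_I)
    fix r :: real assume r: "0 < r"
    \<comment> \<open>Chosen so that \<open>e * (K + 1) = r / 2\<close>; the summand 1 keeps the
      denominator positive when \<open>K = 0\<close>.\<close>
    define e where "e = r / (2 * (K + 1))"
    have e: "0 < e" using r K0 by (simp add: e_def)
    obtain C where C: "0 \<le> C" "\<And>a b :: 'k.
       \<bar>norm (a + b) powr p - norm b powr p\<bar> \<le> e * norm b powr p + C * norm a powr p"
      using powr_perturbation[OF p e] by blast
    \<comment> \<open>The excess of the error, dominated by
      \<open>(C + 1) * norm (f t) powr p\<close> independently of \<open>n\<close>.\<close>
    define W where "W n t = max 0 (\<bar>D n t\<bar> - e * norm (h n t) powr p)" for n t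
    have W_meas [measurable]: "W n \<in> borel_measurable M" for n
      unfolding W_def D_def by measurable
    have W_bd: "norm (W n t) \<le> (C + 1) * norm (f t) powr p" for n t
    proof -
      have *: "\<bar>u - v\<bar> \<le> z \<Longrightarrow> 0 \<le> w \<Longrightarrow> \<bar>u - v - w\<bar> \<le> z + w" for u v w z :: real
        by arith
      have "\<bar>D n t\<bar> \<le> e * norm (h n t) powr p + C * norm (f t) powr p + norm (f t) powr p"
        unfolding D_def by (intro * C(2)) simp
      then show ?thesis using C(1) by (auto simp: W_def algebra_simps)
    qed
    have W_lim: "AE t in M. (\<lambda>n. W n t) \<longlonglongrightarrow> 0"
      using lim
    proof eventually_elim
      case (elim t)
      have "(\<lambda>n. norm (f t + h n t)) \<longlonglongrightarrow> norm (f t + 0)"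
        using elim by (intro tendsto_intros)
      then have "(\<lambda>n. norm (f t + h n t) powr p) \<longlonglongrightarrow> norm (f t + 0) powr p"
        by (rule tendsto_powr2) (use p in auto)
      moreover have b: "(\<lambda>n. norm (h n t) powr p) \<longlonglongrightarrow> 0 powr p"
        by (rule tendsto_powr2) (use elim p in \<open>auto intro!: tendsto_norm_zero\<close>)
      ultimately have "(\<lambda>n. D n t) \<longlonglongrightarrow> norm (f t + 0) powr p - 0 powr p - norm (f t) powr p"
        unfolding D_def using b by (intro tendsto_diff tendsto_const)
      then have "(\<lambda>n. W n t) \<longlonglongrightarrow> max 0 (\<bar>norm (f t + 0) powr p - 0 powr p - norm (f t) powr p\<bar> - e * 0 powr p)"
        unfolding W_def using b
        by (intro tendsto_max tendsto_const tendsto_diff tendsto_rabs tendsto_mult)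
      then show ?case by simp
    qed
    have dom: "integrable M (\<lambda>t. (C + 1) * norm (f t) powr p)" by simp
    have "(\<lambda>n. \<integral>t. W n t \<partial>M) \<longlonglongrightarrow> (\<integral>t. 0 \<partial>M)"
      by (rule integral_dominated_convergence[OF _ _ dom W_lim]) (use W_bd in auto)
    then have "\<forall>\<^sub>F n in sequentially. (\<integral>t. W n t \<partial>M) < r / 2"
      by (rule order_tendstoD) (use r in simp)
    then obtain N where N: "\<And>n. n \<ge> N \<Longrightarrow> (\<integral>t. W n t \<partial>M) < r / 2"
      by (auto simp: eventually_sequentially)
    have W_int: "integrable M (W n)" for n
      by (rule Bochner_Integration.integrable_bound[OF dom]) (use W_bd C(1) in \<open>auto simp: abs_of_nonneg\<close>)
    have "norm ((\<integral>t. D n t \<partial>M) - 0) < r" if "n \<ge> N" for n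
    proof -
      have "\<bar>\<integral>t. D n t \<partial>M\<bar> \<le> (\<integral>t. \<bar>D n t\<bar> \<partial>M)"
        using integral_norm_bound[of M "D n"] by simp
      also have "\<dots> \<le> (\<integral>t. W n t + e * norm (h n t) powr p \<partial>M)"
        using W_int by (intro integral_mono) (auto simp: W_def)
      also have "\<dots> = (\<integral>t. W n t \<partial>M) + e * pint M p (h n)"
        using W_int by (simp add: pint_def)
      also have "\<dots> < r / 2 + e * (K + 1)"
        using N[OF that] K[of n] e by (intro add_less_le_mono mult_left_mono) auto
      also have "\<dots> = r" using K0 by (simp add: e_def field_simps)
      finally show ?thesis by simp
    qed
    then show "\<exists>no. \<forall>n\<ge>no. norm ((\<integral>t. D n t \<partial>M) - 0) < r" by blast
  qed
  then have "(\<lambda>n. (\<integral>t. D n t \<partial>M) + pint M p f) \<longlonglongrightarrow> 0 + pint M p f"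
    by (intro tendsto_intros)
  then show ?thesis by (simp add: D_eq)
qed

lemma tendsto_if_subseq_subseq:
  fixes X :: "nat \<Rightarrow> 'b::metric_space"
  assumes "\<And>r :: nat \<Rightarrow> nat. strict_mono r \<Longrightarrow> \<exists>r' :: nat \<Rightarrow> nat. strict_mono r' \<and> (\<lambda>n. X (r (r' n))) \<longlonglongrightarrow> L"
  shows "X \<longlonglongrightarrow> L"
proof (rule ccontr)
  assume "\<not> X \<longlonglongrightarrow> L"
  then obtain e where e: "0 < e" "\<exists>\<^sub>F n in sequentially. \<not> dist (X n) L < e"
    by (auto simp: tendsto_iff frequently_def)
  then have "infinite {n. \<not> dist (X n) L < e}"
    by (simp add: frequently_cofinite flip: cofinite_eq_sequentially)
  then obtain r :: "nat \<Rightarrow> nat" where r: "strict_mono r" "\<And>n. r n \<in> {n. \<not> dist (X n) L < e}"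
    using infinite_enumerate by blast
  obtain r' where "(\<lambda>n. X (r (r' n))) \<longlonglongrightarrow> L" using assms[OF r(1)] by blast
  then have "\<forall>\<^sub>F n in sequentially. dist (X (r (r' n))) L < e"
    using e(1) by (auto simp: tendsto_iff)
  then show False using r(2) by (auto simp: eventually_sequentially)
qed

text \<open>Convergence to 0 in L_2 yields almost everywhere convergence only along a subsequence.
  Since the limit \<open>pint M p f\<close> is the same for all of them, it suffices to find such a
  subsequence inside every subsequence.\<close>

lemma brezis_lieb_L2:
  fixes f :: "'a \<Rightarrow> 'k::{real_normed_field,euclidean_space}"
  assumes p: "0 < p" and f: "f \<in> Lp_fun M p" and h: "\<And>n. h n \<in> Lp_fun M p"
    and K: "\<And>n. pint M p (h n) \<le> K"
    and int: "\<And>n. integrable M (\<lambda>t. (norm (h n t))\<^sup>2)"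
    and lim: "(\<lambda>n. \<integral>t. (norm (h n t))\<^sup>2 \<partial>M) \<longlonglongrightarrow> 0"
  shows "(\<lambda>n. pint M p (\<lambda>t. f t + h n t) - pint M p (h n)) \<longlonglongrightarrow> pint M p f"
proof (rule tendsto_if_subseq_subseq)
  fix r :: "nat \<Rightarrow> nat" assume r: "strict_mono r"
  have "(\<lambda>n. \<integral>t. norm ((norm (h (r n) t))\<^sup>2) \<partial>M) \<longlonglongrightarrow> 0"
    using LIMSEQ_subseq_LIMSEQ[OF lim r] by (simp add: o_def)
  then obtain r' where r': "strict_mono r'" "AE t in M. (\<lambda>n. (norm (h (r (r' n)) t))\<^sup>2) \<longlonglongrightarrow> 0"
    using tendsto_L1_AE_subseq[of M "\<lambda>n t. (norm (h (r n) t))\<^sup>2"] int by blast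
  have "AE t in M. (\<lambda>n. h (r (r' n)) t) \<longlonglongrightarrow> 0"
    using r'(2)
  proof eventually_elim
    case (elim t)
    then have "(\<lambda>n. sqrt ((norm (h (r (r' n)) t))\<^sup>2)) \<longlonglongrightarrow> sqrt 0"
      by (intro tendsto_intros)
    then show ?case by (simp add: tendsto_norm_zero_iff)
  qed
  then have "(\<lambda>n. pint M p (\<lambda>t. f t + h (r (r' n)) t) - pint M p (h (r (r' n)))) \<longlonglongrightarrow> pint M p f"
    by (intro brezis_lieb_AE[OF p f h K])
  with r'(1) show "\<exists>r'. strict_mono r' \<and>
      (\<lambda>n. pint M p (\<lambda>t. f t + h (r (r' n)) t) - pint M p (h (r (r' n)))) \<longlonglongrightarrow> pint M p f"
    by blast
qed

section \<open>Sequence spaces and the sublinear growth argument\<close>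

lemma sublinear_contradiction:
  fixes d D K a :: real
  assumes "0 < d" "0 < K" "a < 1" "\<And>k::nat. real k * d \<le> D * (1 + real k * K) powr a"
  shows False
proof -
  have "(\<lambda>k. D * (1 + real k * K) powr a / real k) \<longlonglongrightarrow> 0"
    using assms(2,3) by real_asymp
  then have "\<forall>\<^sub>F k in sequentially. D * (1 + real k * K) powr a / real k < d"
    using assms(1) by (rule order_tendstoD)
  then have "\<forall>\<^sub>F k in sequentially. False"
    using eventually_gt_at_top[of 0]
  proof eventually_elim
    case (elim k)
    then show ?case using assms(4)[of k] by (simp add: field_simps)
  qed
  then show False by simp
qed

abbreviation "cs \<equiv> count_space (UNIV :: nat set)"

lemma carrier_lp_space:
  "carrier (lp_space p :: ('k::{real_normed_field,euclidean_space}, nat \<Rightarrow> 'k) normed_sp) = Lp_fun cs p"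
  by (auto simp: lp_space_def Lp_fun_def integrable_count_space_nat_iff)

lemma vnorm_lp_space:
  fixes x :: "nat \<Rightarrow> 'k::{real_normed_field,euclidean_space}"
  assumes "x \<in> Lp_fun cs p"
  shows "vnorm (lp_space p) x = pint cs p x powr (1 / p)"
  using Lp_fun_integrable[OF assms]
  by (simp add: lp_space_def pint_def integral_count_space_nat)

lemma brezis_lieb_lp:
  fixes s :: "nat \<Rightarrow> 'k::{real_normed_field,euclidean_space}"
  assumes "0 < p" "s \<in> Lp_fun cs p" "\<And>n. x n \<in> Lp_fun cs p"
    and "\<And>n. pint cs p (x n) \<le> K" "\<And>i. (\<lambda>n. x n i) \<longlonglongrightarrow> 0"
  shows "(\<lambda>n. pint cs p (\<lambda>i. s i + x n i) - pint cs p (x n)) \<longlonglongrightarrow> pint cs p s"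
  using assms by (intro brezis_lieb_AE[where K = K]) (auto simp: AE_count_space)

text \<open>
  If \<open>\<Phi> (x n)\<close> exceeded some \<open>d > 0\<close> infinitely often, one could add signed terms \<open>x n\<close> one at a
  time, each raising \<open>\<Phi>\<close> by at least \<open>d\<close> but, by the splitting of the norm, the \<open>p\<close>-th power of the
  norm by at most \<open>K + 1\<close>.
\<close>

lemma vanishes_of_sublinear_growth:
  fixes x :: "nat \<Rightarrow> nat \<Rightarrow> 'k::{real_normed_field,euclidean_space}"
    and \<Phi> :: "(nat \<Rightarrow> 'k) \<Rightarrow> real"
  assumes p: "0 < p" and x: "\<And>n. x n \<in> Lp_fun cs p"
    and K: "\<And>n. pint cs p (x n) \<le> K" and null: "\<And>i. (\<lambda>n. x n i) \<longlonglongrightarrow> 0"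
    and nonneg: "\<And>s. 0 \<le> \<Phi> s"
    and step: "\<And>s v. s \<in> Lp_fun cs p \<Longrightarrow> v \<in> Lp_fun cs p \<Longrightarrow>
        \<exists>c\<in>{1,-1}. \<Phi> s + \<Phi> v \<le> \<Phi> (\<lambda>i. s i + c * v i)"
    and growth: "\<And>s. s \<in> Lp_fun cs p \<Longrightarrow> \<Phi> s \<le> D * (1 + pint cs p s) powr a"
    and a: "0 \<le> a" "a < 1"
  shows "(\<lambda>n. \<Phi> (x n)) \<longlonglongrightarrow> 0"
proof (rule ccontr)
  assume "\<not> (\<lambda>n. \<Phi> (x n)) \<longlonglongrightarrow> 0"
  then obtain d where d: "0 < d" "\<exists>\<^sub>F n in sequentially. d \<le> \<Phi> (x n)"
    using nonneg by (auto simp: tendsto_iff frequently_def simp flip: not_less)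
  have K0: "0 \<le> K" using pint_nonneg[of cs p "x 0"] K[of 0] by linarith
  have ex: "\<exists>s\<in>Lp_fun cs p. pint cs p s \<le> real k * (K + 1) \<and> real k * d \<le> \<Phi> s" for k
  proof (induction k)
    case 0
    have "(\<lambda>_. 0) \<in> Lp_fun cs p" "pint cs p (\<lambda>_. 0 :: 'k) = 0"
      by (auto simp: Lp_fun_def pint_def)
    then show ?case using nonneg by (intro bexI[of _ "\<lambda>_. 0"]) auto
  next
    case (Suc k)
    then obtain s where s: "s \<in> Lp_fun cs p" "pint cs p s \<le> real k * (K + 1)" "real k * d \<le> \<Phi> s"
      by blast
    have ev: "\<forall>\<^sub>F n in sequentially. pint cs p (\<lambda>i. s i + c * x n i) - pint cs p (x n) < pint cs p s + 1"
      if "c \<in> {1, -1}" for c :: 'k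
    proof -
      have c: "norm c = 1" using that by auto
      have "(\<lambda>n. pint cs p (\<lambda>i. s i + c * x n i) - pint cs p (\<lambda>i. c * x n i)) \<longlonglongrightarrow> pint cs p s"
        using tendsto_mult_right_zero[OF null] K c
        by (intro brezis_lieb_lp[OF p s(1)] Lp_fun_scale x) (auto simp: pint_scale)
      then show ?thesis
        using c by (auto simp: pint_scale dest: order_tendstoD(2)[where a = "pint cs p s + 1"])
    qed
    \<comment> \<open>The sign \<open>c\<close> is determined by \<open>step\<close> only after
      \<open>n\<close> is fixed, so \<open>n\<close> must serve both signs at once.\<close>
    have "\<forall>\<^sub>F n in sequentially. \<forall>c\<in>{1,-1}. pint cs p (\<lambda>i. s i + c * x n i) - pint cs p (x n) < pint cs p s + 1"
      using ev[of 1] ev[of "-1"] by (simp add: eventually_conj_iff)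
    with d(2) obtain n where n: "d \<le> \<Phi> (x n)"
      "\<And>c. c \<in> {1,-1} \<Longrightarrow> pint cs p (\<lambda>i. s i + c * x n i) - pint cs p (x n) < pint cs p s + 1"
      using frequently_ex[OF frequently_eventually_frequently] by blast
    obtain c where c: "c \<in> {1,-1}" "\<Phi> s + \<Phi> (x n) \<le> \<Phi> (\<lambda>i. s i + c * x n i)"
      using step[OF s(1) x] by blast
    show ?case
    proof (intro bexI conjI)
      show "(\<lambda>i. s i + c * x n i) \<in> Lp_fun cs p"
        using p by (intro Lp_fun_add Lp_fun_scale s x) auto
      show "pint cs p (\<lambda>i. s i + c * x n i) \<le> real (Suc k) * (K + 1)"
        using n(2)[OF c(1)] K[of n] s(2) by (simp add: algebra_simps)
      show "real (Suc k) * d \<le> \<Phi> (\<lambda>i. s i + c * x n i)"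
        using c(2) n(1) s(3) by (simp add: algebra_simps)
    qed
  qed
  have D0: "0 \<le> D"
  proof -
    have "0 \<le> D * (1 + pint cs p (x 0)) powr a"
      using growth[OF x] nonneg order_trans by blast
    moreover have "0 < (1 + pint cs p (x 0)) powr a"
      using pint_nonneg[of cs p "x 0"] by simp
    ultimately show ?thesis by (simp add: zero_le_mult_iff)
  qed
  have "real k * d \<le> D * (1 + real k * (K + 1)) powr a" for k
  proof -
    obtain s where s: "s \<in> Lp_fun cs p" "pint cs p s \<le> real k * (K + 1)" "real k * d \<le> \<Phi> s"
      using ex by blast
    have "\<Phi> s \<le> D * (1 + pint cs p s) powr a" by (rule growth[OF s(1)])
    also have "\<dots> \<le> D * (1 + real k * (K + 1)) powr a"
      using s(2) a D0 pint_nonneg[of cs p s] by (intro mult_left_mono powr_mono2) auto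
    finally show ?thesis using s(3) by simp
  qed
  then show False
    using sublinear_contradiction[OF d(1) _ a(2), of "K + 1" D] K0 by auto
qed

text \<open>The growth argument for \<open>\<Phi> = \<bar>g\<bar>\<close>: the norm bound has
  exponent \<open>1 / p\<close>, which is below 1. It shows that real parts or components of bounded
  functionals tend to 0 along bounded coordinatewise null sequences.\<close>

lemma additive_vanishes:
  fixes x :: "nat \<Rightarrow> nat \<Rightarrow> 'k::{real_normed_field,euclidean_space}"
    and g :: "(nat \<Rightarrow> 'k) \<Rightarrow> real"
  assumes p: "1 < p" and x: "\<And>n. x n \<in> Lp_fun cs p"
    and K: "\<And>n. pint cs p (x n) \<le> K" and null: "\<And>i. (\<lambda>n. x n i) \<longlonglongrightarrow> 0"
    and add: "\<And>s v. s \<in> Lp_fun cs p \<Longrightarrow> v \<in> Lp_fun cs p \<Longrightarrow> g (\<lambda>i. s i + v i) = g s + g v"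
    and bound: "\<And>s. s \<in> Lp_fun cs p \<Longrightarrow> \<bar>g s\<bar> \<le> D * (1 + pint cs p s) powr (1 / p)"
  shows "(\<lambda>n. g (x n)) \<longlonglongrightarrow> 0"
proof -
  have zero: "(\<lambda>_. 0 :: 'k) \<in> Lp_fun cs p" by (simp add: Lp_fun_def)
  have g0: "g (\<lambda>_. 0) = 0" using add[OF zero zero] by simp
  have minus: "g (\<lambda>i. - v i) = - g v" if v: "v \<in> Lp_fun cs p" for v
    using add[OF v Lp_fun_scale[OF v, of "-1"]] g0 by simp
  have "(\<lambda>n. \<bar>g (x n)\<bar>) \<longlonglongrightarrow> 0"
  proof (rule vanishes_of_sublinear_growth[OF _ x K null _ _ bound])
    fix s v :: "nat \<Rightarrow> 'k" assume s: "s \<in> Lp_fun cs p" and v: "v \<in> Lp_fun cs p"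
    have "g (\<lambda>i. s i + - v i) = g s - g v"
      using add[OF s Lp_fun_scale[OF v, of "-1"]] minus[OF v] by simp
    \<comment> \<open>Of two reals, either the sum or the difference has absolute value equal to the
      sum of the absolute values.\<close>
    then show "\<exists>c\<in>{1,-1}. \<bar>g s\<bar> + \<bar>g v\<bar> \<le> \<bar>g (\<lambda>i. s i + c * v i)\<bar>"
      using add[OF s v] by auto
  qed (use p in auto)
  then show ?thesis by (simp add: tendsto_rabs_zero_iff)
qed

section \<open>Operators from l_p to L_p\<close>

text \<open>
  A bounded operator into \<open>L\<^sub>p\<close> after a choice of representatives, hence linear only almost everywhere.
  The real inner product of \<open>'k\<close> lets signs replace unimodular scalars, so that the real and the
  complex case need no distinction.
\<close>

locale Lp_operator = finite_measure M
  for M :: "'a measure" +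
  fixes p :: real and S :: "(nat \<Rightarrow> 'k::{real_normed_field,euclidean_space}) \<Rightarrow> 'a \<Rightarrow> 'k" and C :: real
  assumes p: "2 \<le> p" and C: "0 \<le> C"
    and S_Lp: "x \<in> Lp_fun cs p \<Longrightarrow> S x \<in> Lp_fun M p"
    and S_add: "x \<in> Lp_fun cs p \<Longrightarrow> y \<in> Lp_fun cs p \<Longrightarrow>
        AE t in M. S (\<lambda>i. x i + y i) t = S x t + S y t"
    and S_scale: "x \<in> Lp_fun cs p \<Longrightarrow> AE t in M. S (\<lambda>i. c * x i) t = c * S x t"
    and S_bound: "x \<in> Lp_fun cs p \<Longrightarrow> pint M p (S x) \<le> C * pint cs p x"
begin

text \<open>Truncation at level \<open>t\<close>: above it, the exponent \<open>2 - p\<close> is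
  nonpositive, so \<open>u powr (2 - p)\<close> is at most \<open>t powr (2 - p)\<close>.\<close>

lemma square_le:
  fixes u t :: real
  assumes "0 < t" "0 \<le> u"
  shows "u\<^sup>2 \<le> t\<^sup>2 + t powr (2 - p) * u powr p"
proof (cases "u \<le> t")
  case True
  then show ?thesis using assms power_mono[OF True, of 2] by (simp add: add_increasing2)
next
  case False
  have "u\<^sup>2 = u powr (2 - p) * u powr p"
    using False assms by (simp flip: powr_add)
  also have "\<dots> \<le> t powr (2 - p) * u powr p"
    using False assms p by (intro mult_right_mono powr_mono2') auto
  finally show ?thesis by (simp add: add_increasing)
qed

lemma square_integrable:
  fixes f :: "'a \<Rightarrow> 'k"
  assumes "f \<in> Lp_fun M p"
  shows "integrable M (\<lambda>t. (norm (f t))\<^sup>2)"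
proof (rule Bochner_Integration.integrable_bound)
  show "integrable M (\<lambda>t. 1 + norm (f t) powr p)"
    using Lp_fun_integrable[OF assms] by simp
  show "AE t in M. norm ((norm (f t))\<^sup>2) \<le> norm (1 + norm (f t) powr p)"
    using square_le[of 1] by auto
  show "(\<lambda>t. (norm (f t))\<^sup>2) \<in> borel_measurable M"
    using Lp_fun_measurable[OF assms] by simp
qed

lemma square_integral_le:
  fixes f :: "'a \<Rightarrow> 'k"
  assumes f: "f \<in> Lp_fun M p"
  shows "(\<integral>t. (norm (f t))\<^sup>2 \<partial>M) \<le> (measure M (space M) + 1) * (1 + pint M p f) powr (2 / p)"
proof -
  define N where "N = 1 + pint M p f"
  \<comment> \<open>This level balances the two terms of \<open>square_le\<close>: both become
    multiples of \<open>N powr (2 / p)\<close>.\<close>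
  define t where "t = N powr (1 / p)"
  have N: "1 \<le> N" using pint_nonneg[of M p f] by (simp add: N_def)
  have t: "0 < t" using N by (simp add: t_def)
  have t2: "t\<^sup>2 = N powr (2 / p)"
    using t p by (simp add: t_def powr_powr flip: powr_numeral)
  have tp: "t powr (2 - p) * N = N powr (2 / p)"
  proof -
    have "t powr (2 - p) * N = N powr ((2 - p) / p) * N powr 1"
      using N by (simp add: t_def powr_powr)
    also have "\<dots> = N powr ((2 - p) / p + 1)" by (rule powr_add[symmetric])
    also have "(2 - p) / p + 1 = 2 / p" using p by (simp add: field_simps)
    finally show ?thesis .
  qed
  have "(\<integral>x. (norm (f x))\<^sup>2 \<partial>M) \<le> (\<integral>x. t\<^sup>2 + t powr (2 - p) * norm (f x) powr p \<partial>M)"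
    using square_integrable[OF f] Lp_fun_integrable[OF f] square_le[OF t]
    by (intro integral_mono) auto
  also have "\<dots> = measure M (space M) * t\<^sup>2 + t powr (2 - p) * pint M p f"
    using Lp_fun_integrable[OF f] by (simp add: pint_def)
  also have "\<dots> \<le> measure M (space M) * t\<^sup>2 + t powr (2 - p) * N"
    by (intro add_left_mono mult_left_mono) (auto simp: N_def)
  also have "\<dots> = (measure M (space M) + 1) * N powr (2 / p)"
    by (simp add: tp t2 distrib_right)
  finally show ?thesis by (simp add: N_def)
qed

lemma inner_integrable:
  fixes f g :: "'a \<Rightarrow> 'k"
  assumes "f \<in> Lp_fun M p" "g \<in> Lp_fun M p"
  shows "integrable M (\<lambda>t. f t \<bullet> g t)"
proof (rule Bochner_Integration.integrable_bound)
  show "integrable M (\<lambda>t. (norm (f t))\<^sup>2 + (norm (g t))\<^sup>2)"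
    using assms[THEN square_integrable] by simp
  show "(\<lambda>t. f t \<bullet> g t) \<in> borel_measurable M"
    using assms[THEN Lp_fun_measurable] by simp
  show "AE t in M. norm (f t \<bullet> g t) \<le> norm ((norm (f t))\<^sup>2 + (norm (g t))\<^sup>2)"
  proof (intro AE_I2)
    fix t
    have "norm (f t \<bullet> g t) \<le> norm (f t) * norm (g t)"
      using Cauchy_Schwarz_ineq2 by simp
    also have "\<dots> \<le> (norm (f t))\<^sup>2 + (norm (g t))\<^sup>2"
      using sum_squares_bound[of "norm (f t)" "norm (g t)"]
        mult_nonneg_nonneg[OF norm_ge_zero[of "f t"] norm_ge_zero[of "g t"]]
      by linarith
    finally show "norm (f t \<bullet> g t) \<le> norm ((norm (f t))\<^sup>2 + (norm (g t))\<^sup>2)" by simp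
  qed
qed

lemma square_integral_add:
  fixes f g :: "'a \<Rightarrow> 'k"
  assumes "f \<in> Lp_fun M p" "g \<in> Lp_fun M p"
  shows "(\<integral>t. (norm (f t + g t))\<^sup>2 \<partial>M) =
    (\<integral>t. (norm (f t))\<^sup>2 \<partial>M) + (\<integral>t. (norm (g t))\<^sup>2 \<partial>M) + 2 * (\<integral>t. f t \<bullet> g t \<partial>M)"
proof -
  have "(\<lambda>t. (norm (f t + g t))\<^sup>2) = (\<lambda>t. (norm (f t))\<^sup>2 + (norm (g t))\<^sup>2 + 2 * (f t \<bullet> g t))"
    by (auto simp: power2_norm_eq_inner inner_simps inner_commute)
  then show ?thesis
    using assms[THEN square_integrable] inner_integrable[OF assms] by simp
qed

lemma growth:
  assumes x: "x \<in> Lp_fun cs p"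
  shows "1 + pint M p (S x) \<le> (1 + C) * (1 + pint cs p x)"
  using S_bound[OF x] C pint_nonneg[of cs p x] by (simp add: algebra_simps)

text \<open>The growth argument with the squared L_2 norm of the image as \<open>\<Phi>\<close>. Its
  exponent is \<open>2 / p\<close>, and this is below 1 exactly because
  \<open>p > 2\<close>.\<close>

lemma image_L2_null:
  assumes p2: "2 < p" and x: "\<And>n. x n \<in> Lp_fun cs p"
    and K: "\<And>n. pint cs p (x n) \<le> K" and null: "\<And>i. (\<lambda>n. x n i) \<longlonglongrightarrow> 0"
  shows "(\<lambda>n. \<integral>t. (norm (S (x n) t))\<^sup>2 \<partial>M) \<longlonglongrightarrow> 0"
proof (rule vanishes_of_sublinear_growth[OF _ x K null])
  fix s v :: "nat \<Rightarrow> 'k" assume s: "s \<in> Lp_fun cs p" and v: "v \<in> Lp_fun cs p"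
  note [measurable] = Lp_fun_measurable[OF S_Lp]
  define I where "I = (\<integral>t. S s t \<bullet> S v t \<partial>M)"
  \<comment> \<open>The sign makes the cross term of the squared norm equal to
    \<open>2 * \<bar>I\<bar>\<close>, hence nonnegative.\<close>
  define c :: 'k where "c = (if 0 \<le> I then 1 else -1)"
  have c: "c = 1 \<or> c = -1" by (simp add: c_def)
  have sc: "(\<lambda>i. s i + c * v i) \<in> Lp_fun cs p"
    using p by (intro Lp_fun_add Lp_fun_scale s v) auto
  have "AE t in M. S (\<lambda>i. s i + c * v i) t = S s t + c * S v t"
    using S_add[OF s Lp_fun_scale[OF v, of c]] S_scale[OF v, of c] by eventually_elim simp
  then have "(\<integral>t. (norm (S (\<lambda>i. s i + c * v i) t))\<^sup>2 \<partial>M) = (\<integral>t. (norm (S s t + c * S v t))\<^sup>2 \<partial>M)"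
    using s v sc by (intro integral_cong_AE) auto
  also have "\<dots> = (\<integral>t. (norm (S s t))\<^sup>2 \<partial>M) + (\<integral>t. (norm (c * S v t))\<^sup>2 \<partial>M)
      + 2 * (\<integral>t. S s t \<bullet> (c * S v t) \<partial>M)"
    by (intro square_integral_add S_Lp Lp_fun_scale s v)
  also have "(\<integral>t. (norm (c * S v t))\<^sup>2 \<partial>M) = (\<integral>t. (norm (S v t))\<^sup>2 \<partial>M)"
    using c by auto
  also have "(\<integral>t. S s t \<bullet> (c * S v t) \<partial>M) = \<bar>I\<bar>"
    by (auto simp: c_def I_def)
  finally show "\<exists>c\<in>{1,-1}. (\<integral>t. (norm (S s t))\<^sup>2 \<partial>M) + (\<integral>t. (norm (S v t))\<^sup>2 \<partial>M)
      \<le> (\<integral>t. (norm (S (\<lambda>i. s i + c * v i) t))\<^sup>2 \<partial>M)"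
    using c by (intro bexI[of _ c]) auto
next
  fix s :: "nat \<Rightarrow> 'k" assume s: "s \<in> Lp_fun cs p"
  have "(\<integral>t. (norm (S s t))\<^sup>2 \<partial>M) \<le> (measure M (space M) + 1) * (1 + pint M p (S s)) powr (2 / p)"
    by (rule square_integral_le[OF S_Lp[OF s]])
  also have "\<dots> \<le> (measure M (space M) + 1) * ((1 + C) * (1 + pint cs p s)) powr (2 / p)"
    using p growth[OF s] pint_nonneg[of M p "S s"] by (intro mult_left_mono powr_mono2) auto
  also have "\<dots> = (measure M (space M) + 1) * (1 + C) powr (2 / p) * (1 + pint cs p s) powr (2 / p)"
    using C pint_nonneg[of cs p s] by (simp add: powr_mult)
  finally show "(\<integral>t. (norm (S s t))\<^sup>2 \<partial>M) \<le> \<dots>" .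
qed (use p2 in auto)

text \<open>For \<open>p = 2\<close> the squared norm grows linearly, too fast for the growth
  argument. The pairing with a fixed \<open>y\<close> is additive and grows only like the norm
  itself, so \<open>additive_vanishes\<close> applies.\<close>

lemma image_inner_null:
  fixes y :: "'a \<Rightarrow> 'k"
  assumes p2: "p = 2" and y: "y \<in> Lp_fun M p" and x: "\<And>n. x n \<in> Lp_fun cs p"
    and K: "\<And>n. pint cs p (x n) \<le> K" and null: "\<And>i. (\<lambda>n. x n i) \<longlonglongrightarrow> 0"
  shows "(\<lambda>n. \<integral>t. y t \<bullet> S (x n) t \<partial>M) \<longlonglongrightarrow> 0"
proof (rule additive_vanishes[OF _ x K null])
  fix s v :: "nat \<Rightarrow> 'k" assume s: "s \<in> Lp_fun cs p" and v: "v \<in> Lp_fun cs p"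
  note [measurable] = Lp_fun_measurable[OF S_Lp] Lp_fun_measurable[OF y]
  have sv: "(\<lambda>i. s i + v i) \<in> Lp_fun cs p"
    using p by (intro Lp_fun_add s v) auto
  have "(\<integral>t. y t \<bullet> S (\<lambda>i. s i + v i) t \<partial>M) = (\<integral>t. y t \<bullet> S s t + y t \<bullet> S v t \<partial>M)"
    using S_add[OF s v] s v sv by (intro integral_cong_AE) (auto simp: inner_simps)
  also have "\<dots> = (\<integral>t. y t \<bullet> S s t \<partial>M) + (\<integral>t. y t \<bullet> S v t \<partial>M)"
    using y s v by (intro Bochner_Integration.integral_add inner_integrable S_Lp)
  finally show "(\<integral>t. y t \<bullet> S (\<lambda>i. s i + v i) t \<partial>M) = \<dots>" .
next
  fix s :: "nat \<Rightarrow> 'k" assume s: "s \<in> Lp_fun cs p"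
  \<comment> \<open>The weight for the arithmetic-geometric mean inequality:
    \<open>w\<^sup>2\<close> bounds \<open>pint M p (S s)\<close>, so both terms become linear in
    \<open>w\<close>, which carries the required exponent 1/2.\<close>
  define w where "w = ((1 + C) * (1 + pint cs p s)) powr (1 / 2)"
  have pos: "0 < (1 + C) * (1 + pint cs p s)"
    using C pint_nonneg[of cs p s] by simp
  have w: "0 < w" using C pint_nonneg[of cs p s] by (simp add: w_def add_nonneg_eq_0_iff)
  have ww: "w\<^sup>2 = (1 + C) * (1 + pint cs p s)"
    using pos by (simp add: w_def powr_half_sqrt)
  have n2: "pint M p f = (\<integral>t. (norm (f t))\<^sup>2 \<partial>M)" for f :: "'a \<Rightarrow> 'k"
    by (simp add: pint_def p2)
  have amgm: "\<bar>a \<bullet> b\<bar> \<le> w * (norm a)\<^sup>2 + (norm b)\<^sup>2 / w" for a b :: 'k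
  proof -
    have "0 \<le> (w * norm a - norm b)\<^sup>2 / w" using w by simp
    also have "\<dots> = w * (norm a)\<^sup>2 + (norm b)\<^sup>2 / w - 2 * (norm a * norm b)"
      using w by (simp add: power2_eq_square field_simps)
    finally show ?thesis
      using Cauchy_Schwarz_ineq2[of a b] mult_nonneg_nonneg[OF norm_ge_zero[of a] norm_ge_zero[of b]]
      by linarith
  qed
  have "\<bar>\<integral>t. y t \<bullet> S s t \<partial>M\<bar> \<le> (\<integral>t. \<bar>y t \<bullet> S s t\<bar> \<partial>M)"
    using integral_norm_bound[of M "\<lambda>t. y t \<bullet> S s t"] by simp
  also have "\<dots> \<le> (\<integral>t. w * (norm (y t))\<^sup>2 + (norm (S s t))\<^sup>2 / w \<partial>M)"
    using amgm inner_integrable[OF y S_Lp[OF s]] square_integrable[OF y] square_integrable[OF S_Lp[OF s]]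
    by (intro integral_mono) auto
  also have "\<dots> = w * pint M p y + pint M p (S s) / w"
    using square_integrable[OF y] square_integrable[OF S_Lp[OF s]] by (simp add: n2)
  also have "\<dots> \<le> w * pint M p y + w\<^sup>2 / w"
    using growth[OF s] w by (intro add_left_mono divide_right_mono) (auto simp: ww)
  also have "\<dots> = (pint M p y + 1) * w"
    using w by (simp add: power2_eq_square algebra_simps)
  also have "\<dots> = (pint M p y + 1) * (1 + C) powr (1 / 2) * (1 + pint cs p s) powr (1 / p)"
    using C pint_nonneg[of cs p s] by (simp add: w_def powr_mult p2)
  finally show "\<bar>\<integral>t. y t \<bullet> S s t \<partial>M\<bar> \<le> \<dots>" .
qed (use p in auto)

lemma image_splitting:
  fixes y :: "'a \<Rightarrow> 'k"
  assumes y: "y \<in> Lp_fun M p" and x: "\<And>n. x n \<in> Lp_fun cs p"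
    and K: "\<And>n. pint cs p (x n) \<le> K" and null: "\<And>i. (\<lambda>n. x n i) \<longlonglongrightarrow> 0"
  shows "(\<lambda>n. pint M p (\<lambda>t. y t + S (x n) t) - pint M p (S (x n))) \<longlonglongrightarrow> pint M p y"
proof (cases "p = 2")
  case True
  \<comment> \<open>In the Hilbert space case the splitting error is exactly the cross term.\<close>
  have "pint M p (\<lambda>t. y t + S (x n) t) - pint M p (S (x n)) = pint M p y + 2 * (\<integral>t. y t \<bullet> S (x n) t \<partial>M)" for n
    using square_integral_add[OF y S_Lp[OF x]] by (simp add: pint_def True)
  moreover have "(\<lambda>n. pint M p y + 2 * (\<integral>t. y t \<bullet> S (x n) t \<partial>M)) \<longlonglongrightarrow> pint M p y + 2 * 0"
    by (intro tendsto_intros image_inner_null[OF True y x K null])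
  ultimately show ?thesis by simp
next
  case False
  then have p2: "2 < p" using p by simp
  have "pint M p (S (x n)) \<le> C * K" for n
    using S_bound[OF x] mult_left_mono[OF K C] order_trans by blast
  then show ?thesis
    using p2 by (intro brezis_lieb_L2[where K = "C * K"] y S_Lp x square_integrable
        image_L2_null[OF p2 x K null]) auto
qed

end

section \<open>Coordinatewise limits of bounded sequences in l_p\<close>

text \<open>The sequence lives in a countable product of closed balls, which is compact by
  Tychonoff's theorem and therefore sequentially compact; convergence in the product is
  coordinatewise.\<close>

lemma coordinatewise_convergent_subseq:
  fixes x :: "nat \<Rightarrow> nat \<Rightarrow> 'k::euclidean_space"
  assumes "\<And>n i. norm (x n i) \<le> B"
  obtains r s where "strict_mono r" "\<And>i. (\<lambda>n. x (r n) i) \<longlonglongrightarrow> s i"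
proof -
  have "compactin (product_topology (\<lambda>_. euclidean) UNIV) (PiE UNIV (\<lambda>_::nat. cball (0::'k) B))"
    by (simp add: compactin_PiE)
  then have "compact (PiE UNIV (\<lambda>_::nat. cball (0::'k) B))"
    by (simp add: euclidean_product_topology)
  then have "seq_compact (PiE UNIV (\<lambda>_::nat. cball (0::'k) B))"
    by (rule compact_imp_seq_compact)
  moreover have "\<forall>n. x n \<in> PiE UNIV (\<lambda>_::nat. cball (0::'k) B)"
    using assms by auto
  ultimately obtain s r where r: "strict_mono r" "(x \<circ> r) \<longlonglongrightarrow> s"
    unfolding seq_compact_def by meson
  have "(\<lambda>n. x (r n) i) \<longlonglongrightarrow> s i" for i
    using continuous_on_tendsto_compose[OF continuous_on_product_coordinates r(2)] by simp
  with r(1) show ?thesis by (rule that)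
qed

lemma norm_coordinate_le:
  fixes x :: "nat \<Rightarrow> 'k::{real_normed_field,euclidean_space}"
  assumes p: "0 < p" and x: "x \<in> Lp_fun cs p" and K: "pint cs p x \<le> K"
  shows "(\<Sum>i<N. norm (x i) powr p) \<le> K" "norm (x i) \<le> K powr (1 / p)"
proof -
  have sm: "summable (\<lambda>n. norm (x n) powr p)" "pint cs p x = (\<Sum>n. norm (x n) powr p)"
    using Lp_fun_integrable[OF x]
    by (auto simp: pint_def integral_count_space_nat integrable_count_space_nat_iff)
  have le: "(\<Sum>i<n. norm (x i) powr p) \<le> K" for n
    using K sum_le_suminf[OF sm(1), of "{..<n}"] unfolding sm(2) by fastforce
  then show "(\<Sum>i<N. norm (x i) powr p) \<le> K" .
  have "norm (x i) powr p \<le> (\<Sum>i<Suc i. norm (x i) powr p)"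
    by (rule member_le_sum) auto
  also note le
  finally have "norm (x i) powr p \<le> K" .
  then have "(norm (x i) powr p) powr (1 / p) \<le> K powr (1 / p)"
    using p by (intro powr_mono2) auto
  then show "norm (x i) \<le> K powr (1 / p)"
    using p by (simp add: powr_powr)
qed

text \<open>The bound \<open>K\<close> holds for every finite partial sum of every
  \<open>x n\<close>, so it passes to the partial sums of the limit.\<close>

lemma coordinatewise_limit_in_lp:
  fixes s :: "nat \<Rightarrow> 'k::{real_normed_field,euclidean_space}"
  assumes p: "0 < p" and x: "\<And>n. x n \<in> Lp_fun cs p" and K: "\<And>n. pint cs p (x n) \<le> K"
    and lim: "\<And>i. (\<lambda>n. x n i) \<longlonglongrightarrow> s i"
  shows "s \<in> Lp_fun cs p"
proof -
  have "(\<Sum>i<N. norm (s i) powr p) \<le> K" for N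
  proof (rule Lim_bounded)
    show "(\<lambda>n. \<Sum>i<N. norm (x n i) powr p) \<longlonglongrightarrow> (\<Sum>i<N. norm (s i) powr p)"
    proof (rule tendsto_sum)
      fix i
      show "(\<lambda>n. norm (x n i) powr p) \<longlonglongrightarrow> norm (s i) powr p"
        by (rule tendsto_powr2[OF tendsto_norm[OF lim] tendsto_const]) (use p in auto)
    qed
    show "\<forall>n\<ge>0. (\<Sum>i<N. norm (x n i) powr p) \<le> K"
      using norm_coordinate_le(1)[OF p x K] by blast
  qed
  then have "summable (\<lambda>i. norm (s i) powr p)"
    by (intro summableI_nonneg_bounded[where x = K]) auto
  then show ?thesis by (simp add: Lp_fun_def integrable_count_space_nat_iff)
qed

section \<open>Comparison of the two splittings\<close>

context Lp_operator
begin

text \<open>The core of property (m), for p-th powers. Boundedness of the sequence, which both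
  splittings require, is extracted from the bound \<open>L\<close> on \<open>y + S (x n)\<close> by
  way of \<open>lower\<close>.\<close>

lemma eventually_pint_less:
  assumes lower: "\<And>x. x \<in> Lp_fun cs p \<Longrightarrow> pint cs p x \<le> pint M p (S x)"
    and s: "s \<in> Lp_fun cs p" and y: "y \<in> Lp_fun M p" and sy: "pint cs p s \<le> pint M p y"
    and x: "\<And>n. x n \<in> Lp_fun cs p" and null: "\<And>i. (\<lambda>n. x n i) \<longlonglongrightarrow> 0"
    and L: "\<forall>\<^sub>F n in sequentially. pint M p (\<lambda>t. y t + S (x n) t) \<le> L" and LL: "L < L'"
  shows "\<forall>\<^sub>F n in sequentially. pint cs p (\<lambda>i. s i + x n i) < L'"
proof -
  have p0: "0 < p" "0 \<le> p" using p by auto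
  obtain N where N: "\<And>n. n \<ge> N \<Longrightarrow> pint M p (\<lambda>t. y t + S (x n) t) \<le> L"
    using L by (auto simp: eventually_sequentially)
  \<comment> \<open>Passing to a tail makes the bound \<open>L\<close>, and with it
    \<open>K\<close>, valid for every index.\<close>
  define z where "z n = x (n + N)" for n
  have z: "z n \<in> Lp_fun cs p" for n using x by (simp add: z_def)
  have zL: "pint M p (\<lambda>t. y t + S (z n) t) \<le> L" for n using N by (simp add: z_def)
  have znull: "(\<lambda>n. z n i) \<longlonglongrightarrow> 0" for i
    unfolding z_def using LIMSEQ_ignore_initial_segment[OF null] .
  define K where "K = 2 powr p * (L + pint M p y)"
  have K: "pint cs p (z n) \<le> K" for n
  proof -
    have "pint M p (S (z n)) = pint M p (\<lambda>t. (y t + S (z n) t) + (-1) * y t)" by simp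
    also have "\<dots> \<le> 2 powr p * (pint M p (\<lambda>t. y t + S (z n) t) + pint M p (\<lambda>t. (-1) * y t))"
      by (intro pint_add_le Lp_fun_add Lp_fun_scale y S_Lp z p0)
    also have "\<dots> \<le> K"
      unfolding K_def pint_scale using zL by (intro mult_left_mono) auto
    finally show ?thesis using lower[OF z] order_trans by blast
  qed
  \<comment> \<open>Each splitting costs an error \<open>e\<close>, and together they use up exactly
    the gap \<open>L' - L\<close>.\<close>
  define e where "e = (L' - L) / 2"
  have e: "0 < e" using LL by (simp add: e_def)
  have "\<forall>\<^sub>F n in sequentially. pint cs p (\<lambda>i. s i + z n i) - pint cs p (z n) < pint cs p s + e"
    using brezis_lieb_lp[OF p0(1) s z K znull] e by (intro order_tendstoD(2)) auto
  moreover have "\<forall>\<^sub>F n in sequentially. pint M p (\<lambda>t. y t + S (z n) t) - pint M p (S (z n)) > pint M p y - e"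
    using image_splitting[OF y z K znull] e by (intro order_tendstoD(1)) auto
  ultimately have "\<forall>\<^sub>F n in sequentially. pint cs p (\<lambda>i. s i + z n i) < L'"
  proof eventually_elim
    case (elim n)
    then show ?case using zL[of n] lower[OF z, of n] sy unfolding e_def by argo
  qed
  then show ?thesis
    unfolding z_def by (subst (asm) eventually_sequentially_seg)
qed

text \<open>Along a subsequence the sequence is \<open>s + w n\<close> with \<open>w n\<close>
  coordinatewise null, and \<open>g\<close> prevents \<open>s\<close> from being 0. By the
  splittings, the p-th powers of the norms of \<open>w n\<close> and \<open>S (w n)\<close> tend to
  \<open>1 - pint cs p s\<close> and \<open>m - pint M p (S s)\<close>; applying
  \<open>lower\<close> to \<open>w n\<close> and taking limits gives the claim. Here
  \<open>m\<close> plays the p-th power of the minimum modulus.\<close>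

lemma minimizer_of_minimizing_seq:
  assumes x: "\<And>n. x n \<in> Lp_fun cs p" and unit: "\<And>n. pint cs p (x n) = 1"
    and lim: "(\<lambda>n. pint M p (S (x n))) \<longlonglongrightarrow> m"
    and lower: "\<And>x. x \<in> Lp_fun cs p \<Longrightarrow> m * pint cs p x \<le> pint M p (S x)"
    and add: "\<And>s v. s \<in> Lp_fun cs p \<Longrightarrow> v \<in> Lp_fun cs p \<Longrightarrow> g (\<lambda>i. s i + v i) = g s + g v"
    and bound: "\<And>s. s \<in> Lp_fun cs p \<Longrightarrow> \<bar>g s\<bar> \<le> D * (1 + pint cs p s) powr (1 / p)"
    and not_null: "\<not> (\<lambda>n. g (x n)) \<longlonglongrightarrow> 0"
  obtains s where "s \<in> Lp_fun cs p" "pint cs p s \<noteq> 0" "pint M p (S s) \<le> m * pint cs p s"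
proof -
  have p0: "0 < p" "0 \<le> p" using p by auto
  \<comment> \<open>A first subsequence keeps \<open>g\<close> away from 0, so that every later
    subsequence does too.\<close>
  obtain e where e: "0 < e" "\<exists>\<^sub>F n in sequentially. e \<le> \<bar>g (x n)\<bar>"
    using not_null by (auto simp: tendsto_iff frequently_def simp flip: not_less)
  then have "infinite {n. e \<le> \<bar>g (x n)\<bar>}"
    by (simp add: frequently_cofinite flip: cofinite_eq_sequentially)
  then obtain r1 :: "nat \<Rightarrow> nat" where r1: "strict_mono r1" "\<And>n. r1 n \<in> {n. e \<le> \<bar>g (x n)\<bar>}"
    using infinite_enumerate by blast
  have "norm (x (r1 n) i) \<le> 1 powr (1 / p)" for n i
    by (rule norm_coordinate_le[OF p0(1) x]) (simp add: unit)
  then obtain r2 s where r2: "strict_mono r2" "\<And>i. (\<lambda>n. x (r1 (r2 n)) i) \<longlonglongrightarrow> s i"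
    using coordinatewise_convergent_subseq[of "\<lambda>n. x (r1 n)"] by metis
  define z where "z n = x (r1 (r2 n))" for n
  have z: "z n \<in> Lp_fun cs p" "pint cs p (z n) = 1" for n
    using x unit by (auto simp: z_def)
  have zs: "(\<lambda>n. z n i) \<longlonglongrightarrow> s i" for i using r2(2) by (simp add: z_def)
  have s: "s \<in> Lp_fun cs p"
    by (rule coordinatewise_limit_in_lp[OF p0(1) z(1) _ zs, of 1]) (simp add: z(2))
  have s0: "pint cs p s \<noteq> 0"
  proof
    assume s0: "pint cs p s = 0"
    \<comment> \<open>The coordinate bound with \<open>K = 0\<close> reads
      \<open>norm (s i) \<le> 0\<close>, since \<open>0 powr (1 / p) = 0\<close>.\<close>
    have "s i = 0" for i
      using norm_coordinate_le(2)[OF p0(1) s, of 0 i] s0 by simp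
    then have "(\<lambda>n. z n i) \<longlonglongrightarrow> 0" for i using zs by metis
    then have "(\<lambda>n. g (z n)) \<longlonglongrightarrow> 0"
      using p z by (intro additive_vanishes[where g = g and K = 1 and p = p, OF _ _ _ _ add bound]) auto
    then have "\<forall>\<^sub>F n in sequentially. \<bar>g (z n)\<bar> < e"
      using e(1) by (simp add: tendsto_iff)
    then show False
      using r1(2) by (auto simp: z_def eventually_sequentially not_less[symmetric])
  qed
  define w where "w n = (\<lambda>i. z n i + (-1) * s i)" for n
  have w: "w n \<in> Lp_fun cs p" for n
    unfolding w_def by (intro Lp_fun_add Lp_fun_scale z s p0)
  have wK: "pint cs p (w n) \<le> 2 powr p * (1 + pint cs p s)" for n
    unfolding w_def using pint_add_le[OF z(1)[of n] Lp_fun_scale[OF s, of "-1"] p0(2)]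
    unfolding pint_scale z(2) by simp
  have wnull: "(\<lambda>n. w n i) \<longlonglongrightarrow> 0" for i
    unfolding w_def using tendsto_diff[OF zs[of i] tendsto_const[of "s i"]] by simp
  have zw: "z n = (\<lambda>i. s i + w n i)" for n by (simp add: w_def)
  have "(\<lambda>n. 1 - pint cs p (w n)) \<longlonglongrightarrow> pint cs p s"
    using brezis_lieb_lp[OF p0(1) s w wK wnull] by (simp add: z(2) flip: zw)
  from tendsto_diff[OF tendsto_const this, of 1]
  have A: "(\<lambda>n. pint cs p (w n)) \<longlonglongrightarrow> 1 - pint cs p s" by simp
  have "strict_mono (\<lambda>n. r1 (r2 n))"
    using strict_mono_o[OF r1(1) r2(1)] by (simp add: o_def)
  then have Tz: "(\<lambda>n. pint M p (S (z n))) \<longlonglongrightarrow> m"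
    unfolding z_def using LIMSEQ_subseq_LIMSEQ[OF lim] by (simp add: o_def)
  have "pint M p (\<lambda>t. S s t + S (w n) t) = pint M p (S (z n))" for n
  proof (rule pint_cong_AE)
    show "AE t in M. S s t + S (w n) t = S (z n) t"
      using S_add[OF s w[of n]] unfolding zw by auto
  qed (use Lp_fun_measurable[OF S_Lp] s w z in auto)
  then have "(\<lambda>n. pint M p (S (z n)) - pint M p (S (w n))) \<longlonglongrightarrow> pint M p (S s)"
    using image_splitting[OF S_Lp[OF s] w wK wnull] by simp
  from tendsto_diff[OF Tz this]
  have B: "(\<lambda>n. pint M p (S (w n))) \<longlonglongrightarrow> m - pint M p (S s)" by simp
  have "m * (1 - pint cs p s) \<le> m - pint M p (S s)"
    by (rule LIMSEQ_le[OF tendsto_mult_left[OF A] B]) (use lower w in blast)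
  then have "pint M p (S s) \<le> m * pint cs p s" by (simp add: algebra_simps)
  with s s0 show ?thesis by (rule that)
qed

end

section \<open>Classes modulo equality almost everywhere\<close>

definition Lp_rep :: "('a \<Rightarrow> 'k) set \<Rightarrow> 'a \<Rightarrow> 'k" where
  "Lp_rep A = (SOME f. f \<in> A)"

lemma Lp_class_self: "f \<in> Lp_fun M p \<Longrightarrow> f \<in> Lp_class M p f"
  by (simp add: Lp_class_def)

lemma Lp_class_cong:
  assumes "AE t in M. f t = g t"
  shows "Lp_class M p f = Lp_class M p g"
proof -
  have "(AE t in M. h t = f t) \<longleftrightarrow> (AE t in M. h t = g t)" for h
    using assms by (intro eventually_cong) auto
  then show ?thesis by (simp add: Lp_class_def)
qed

lemma carrier_Lp_space: "carrier (Lp_space M p) = Lp_class M p ` Lp_fun M p"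
  by (simp add: Lp_space_def)

lemma Lp_rep:
  assumes "A \<in> carrier (Lp_space M p)"
  shows "Lp_rep A \<in> Lp_fun M p" "Lp_class M p (Lp_rep A) = A"
proof -
  obtain f where f: "f \<in> Lp_fun M p" "A = Lp_class M p f"
    using assms by (auto simp: carrier_Lp_space)
  then have "f \<in> A" by (simp add: Lp_class_self)
  then have "Lp_rep A \<in> A" unfolding Lp_rep_def by (rule someI[of "\<lambda>f. f \<in> A"])
  then have r: "Lp_rep A \<in> Lp_fun M p" "AE t in M. Lp_rep A t = f t"
    unfolding f(2) by (auto simp: Lp_class_def)
  show "Lp_rep A \<in> Lp_fun M p" by (rule r(1))
  show "Lp_class M p (Lp_rep A) = A" unfolding f(2)
    using r(2) unfolding f(2) by (rule Lp_class_cong)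
qed

lemma AE_Lp_rep_class:
  assumes "f \<in> Lp_fun M p"
  shows "AE t in M. Lp_rep (Lp_class M p f) t = f t"
proof -
  have A: "Lp_class M p f \<in> carrier (Lp_space M p)"
    using assms by (simp add: carrier_Lp_space)
  have "Lp_rep (Lp_class M p f) \<in> Lp_class M p f"
    using Lp_class_self[OF Lp_rep(1)[OF A]] Lp_rep(2)[OF A] by simp
  then show ?thesis by (simp add: Lp_class_def)
qed

text \<open>All members of a class have the same integral, so the image under
  \<open>the_elem\<close> is a singleton.\<close>

lemma vnorm_Lp_space:
  fixes A :: "('a \<Rightarrow> 'k::{real_normed_field,euclidean_space}) set"
  assumes A: "A \<in> carrier (Lp_space M p)"
  shows "vnorm (Lp_space M p) A = pint M p (Lp_rep A) powr (1 / p)"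
proof -
  note r = Lp_rep[OF A]
  have "pint M p f = pint M p (Lp_rep A)" if "f \<in> A" for f
  proof -
    have "f \<in> Lp_class M p (Lp_rep A)" using that r(2) by simp
    then show ?thesis
      using r(1) by (intro pint_cong_AE) (auto simp: Lp_class_def Lp_fun_def)
  qed
  then have "(\<lambda>f. (\<integral>t. norm (f t) powr p \<partial>M) powr (1 / p)) ` A = (\<lambda>f. pint M p (Lp_rep A) powr (1 / p)) ` A"
    unfolding pint_def by (intro image_cong refl) metis
  also have "\<dots> = {pint M p (Lp_rep A) powr (1 / p)}"
    using Lp_class_self[OF r(1)] unfolding r(2) by (rule image_constant)
  finally have "(\<lambda>f. (\<integral>t. norm (f t) powr p \<partial>M) powr (1 / p)) ` A = {pint M p (Lp_rep A) powr (1 / p)}" .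
  then show ?thesis by (simp add: Lp_space_def)
qed

text \<open>The union defining \<open>vadd\<close> runs over nonempty index sets, and all its
  members are the same class; hence it is the class of the sum of the chosen
  representatives.\<close>

lemma AE_Lp_rep_vadd:
  fixes A B :: "('a \<Rightarrow> 'k::{real_normed_field,euclidean_space}) set"
  assumes A: "A \<in> carrier (Lp_space M p)" and B: "B \<in> carrier (Lp_space M p)" and p: "0 \<le> p"
  shows "vadd (Lp_space M p) A B \<in> carrier (Lp_space M p)"
    and "AE t in M. Lp_rep (vadd (Lp_space M p) A B) t = Lp_rep A t + Lp_rep B t"
proof -
  note rA = Lp_rep[OF A] note rB = Lp_rep[OF B]
  have eq: "Lp_class M p (\<lambda>t. f t + g t) = Lp_class M p (\<lambda>t. Lp_rep A t + Lp_rep B t)"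
    if "f \<in> A" "g \<in> B" for f g
  proof (rule Lp_class_cong)
    have "f \<in> Lp_class M p (Lp_rep A)" "g \<in> Lp_class M p (Lp_rep B)" using that rA rB by auto
    then have "AE t in M. f t = Lp_rep A t" "AE t in M. g t = Lp_rep B t"
      by (auto simp: Lp_class_def)
    then show "AE t in M. f t + g t = Lp_rep A t + Lp_rep B t" by eventually_elim simp
  qed
  have "A \<noteq> {}" "B \<noteq> {}"
    using Lp_class_self[OF rA(1)] Lp_class_self[OF rB(1)] rA(2) rB(2) by auto
  have "vadd (Lp_space M p) A B = (\<Union>f\<in>A. \<Union>g\<in>B. Lp_class M p (\<lambda>t. f t + g t))"
    by (simp add: Lp_space_def)
  also have "\<dots> = (\<Union>f\<in>A. \<Union>g\<in>B. Lp_class M p (\<lambda>t. Lp_rep A t + Lp_rep B t))"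
    by (intro SUP_cong refl eq)
  also have "\<dots> = Lp_class M p (\<lambda>t. Lp_rep A t + Lp_rep B t)"
    using \<open>A \<noteq> {}\<close> \<open>B \<noteq> {}\<close> by simp
  finally have eq: "vadd (Lp_space M p) A B = Lp_class M p (\<lambda>t. Lp_rep A t + Lp_rep B t)" .
  note m = Lp_fun_add[OF rA(1) rB(1) p]
  show "vadd (Lp_space M p) A B \<in> carrier (Lp_space M p)"
    unfolding eq using m by (simp add: carrier_Lp_space)
  show "AE t in M. Lp_rep (vadd (Lp_space M p) A B) t = Lp_rep A t + Lp_rep B t"
    unfolding eq using AE_Lp_rep_class[OF m] .
qed

lemma AE_Lp_rep_vscale:
  fixes A :: "('a \<Rightarrow> 'k::{real_normed_field,euclidean_space}) set"
  assumes A: "A \<in> carrier (Lp_space M p)"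
  shows "AE t in M. Lp_rep (vscale (Lp_space M p) c A) t = c * Lp_rep A t"
proof -
  note rA = Lp_rep[OF A]
  have eq: "Lp_class M p (\<lambda>t. c * f t) = Lp_class M p (\<lambda>t. c * Lp_rep A t)" if "f \<in> A" for f
  proof (rule Lp_class_cong)
    have "f \<in> Lp_class M p (Lp_rep A)" using that rA by auto
    then have "AE t in M. f t = Lp_rep A t" by (auto simp: Lp_class_def)
    then show "AE t in M. c * f t = c * Lp_rep A t" by eventually_elim simp
  qed
  have "A \<noteq> {}" using Lp_class_self[OF rA(1)] rA(2) by auto
  have "vscale (Lp_space M p) c A = (\<Union>f\<in>A. Lp_class M p (\<lambda>t. c * f t))"
    by (simp add: Lp_space_def)
  also have "\<dots> = (\<Union>f\<in>A. Lp_class M p (\<lambda>t. c * Lp_rep A t))"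
    by (intro SUP_cong refl eq)
  also have "\<dots> = Lp_class M p (\<lambda>t. c * Lp_rep A t)"
    using \<open>A \<noteq> {}\<close> by simp
  finally have eq: "vscale (Lp_space M p) c A = Lp_class M p (\<lambda>t. c * Lp_rep A t)" .
  show ?thesis unfolding eq using AE_Lp_rep_class[OF Lp_fun_scale[OF rA(1)]] .
qed

section \<open>From normed spaces to integrals of p-th powers\<close>

lemma powr_root_le_iff:
  fixes a c p :: real
  assumes "0 < p" "0 \<le> a" "0 \<le> c"
  shows "a powr (1 / p) \<le> c \<longleftrightarrow> a \<le> c powr p" "c \<le> a powr (1 / p) \<longleftrightarrow> c powr p \<le> a"
proof -
  have a: "(a powr (1 / p)) powr p = a" using assms by (simp add: powr_powr)
  have iff: "x \<le> y \<longleftrightarrow> x powr p \<le> y powr p" if "0 \<le> x" "0 \<le> y" for x y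
  proof
    show "x powr p \<le> y powr p" if "x \<le> y"
      using assms(1) \<open>0 \<le> x\<close> that by (intro powr_mono2) simp_all
    show "x \<le> y" if le: "x powr p \<le> y powr p"
    proof (rule ccontr)
      assume "\<not> x \<le> y"
      then have "y powr p < x powr p"
        using assms(1) \<open>0 \<le> y\<close> by (intro powr_less_mono2) simp_all
      with le show False by simp
    qed
  qed
  show "a powr (1 / p) \<le> c \<longleftrightarrow> a \<le> c powr p"
    using iff[OF powr_ge_zero[of a "1 / p"] assms(3)] unfolding a .
  show "c \<le> a powr (1 / p) \<longleftrightarrow> c powr p \<le> a"
    using iff[OF assms(3) powr_ge_zero[of a "1 / p"]] unfolding a .
qed

lemma vadd_lp_space: "vadd (lp_space p) x y = (\<lambda>i. x i + y i)"
  and vscale_lp_space: "vscale (lp_space p) c x = (\<lambda>i. c * x i)"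
  by (simp_all add: lp_space_def)

lemma bounded_opsD:
  assumes "T \<in> bounded_ops X Y"
  shows "x \<in> carrier X \<Longrightarrow> T x \<in> carrier Y"
    and "x \<in> carrier X \<Longrightarrow> x' \<in> carrier X \<Longrightarrow> T (vadd X x x') = vadd Y (T x) (T x')"
    and "x \<in> carrier X \<Longrightarrow> T (vscale X c x) = vscale Y c (T x)"
    and "\<exists>C. \<forall>x\<in>carrier X. vnorm Y (T x) \<le> C * vnorm X x"
  using assms unfolding bounded_ops_def by blast+

lemma bounded_ops_Lp_operator:
  fixes T :: "(nat \<Rightarrow> 'k::{real_normed_field,euclidean_space}) \<Rightarrow> ('a \<Rightarrow> 'k) set"
  assumes M: "finite_measure M" and p: "2 \<le> p"
    and T: "T \<in> bounded_ops (lp_space p) (Lp_space M p)"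
  obtains C where "Lp_operator M p (\<lambda>x. Lp_rep (T x)) C"
proof -
  have T_carrier: "T x \<in> carrier (Lp_space M p)" if "x \<in> Lp_fun cs p" for x
    using bounded_opsD(1)[OF T] that unfolding carrier_lp_space .
  have "\<exists>C. \<forall>x\<in>Lp_fun cs p. vnorm (Lp_space M p) (T x) \<le> C * vnorm (lp_space p) x"
    using bounded_opsD(4)[OF T] unfolding carrier_lp_space .
  then obtain C where C: "\<forall>x\<in>Lp_fun cs p. vnorm (Lp_space M p) (T x) \<le> C * vnorm (lp_space p) x" ..
  \<comment> \<open>The operator bound \<open>C\<close> may be negative, hence the absolute value;
    the p-th power matches the scale of \<open>pint\<close>.\<close>
  have "Lp_operator M p (\<lambda>x. Lp_rep (T x)) (\<bar>C\<bar> powr p)"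
  proof (intro Lp_operator.intro Lp_operator_axioms.intro M p)
    fix x y :: "nat \<Rightarrow> 'k" and c :: 'k
    assume x: "x \<in> Lp_fun cs p"
    show "Lp_rep (T x) \<in> Lp_fun M p" by (rule Lp_rep(1)[OF T_carrier[OF x]])
    have "T (\<lambda>i. c * x i) = vscale (Lp_space M p) c (T x)"
      using bounded_opsD(3)[OF T] x unfolding carrier_lp_space vscale_lp_space .
    then show "AE t in M. Lp_rep (T (\<lambda>i. c * x i)) t = c * Lp_rep (T x) t"
      using AE_Lp_rep_vscale[OF T_carrier[OF x]] by simp
    have "pint M p (Lp_rep (T x)) powr (1 / p) \<le> C * pint cs p x powr (1 / p)"
      using bspec[OF C x] by (simp add: vnorm_Lp_space T_carrier vnorm_lp_space x)
    also have "\<dots> \<le> \<bar>C\<bar> * pint cs p x powr (1 / p)"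
      by (rule mult_right_mono[OF abs_ge_self powr_ge_zero])
    finally have "pint M p (Lp_rep (T x)) \<le> (\<bar>C\<bar> * pint cs p x powr (1 / p)) powr p"
      using p by (subst (asm) powr_root_le_iff(1)) (simp_all add: pint_nonneg)
    then show "pint M p (Lp_rep (T x)) \<le> \<bar>C\<bar> powr p * pint cs p x"
      using p pint_nonneg[of cs p x] by (simp add: powr_mult powr_powr)
    assume y: "y \<in> Lp_fun cs p"
    have "T (\<lambda>i. x i + y i) = vadd (Lp_space M p) (T x) (T y)"
      using bounded_opsD(2)[OF T] x y unfolding carrier_lp_space vadd_lp_space .
    then show "AE t in M. Lp_rep (T (\<lambda>i. x i + y i)) t = Lp_rep (T x) t + Lp_rep (T y) t"
      using AE_Lp_rep_vadd(2)[OF T_carrier[OF x] T_carrier[OF y]] p by simp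
  qed auto
  then show ?thesis by (rule that)
qed

lemma (in Lp_operator) normalized:
  assumes s: "s \<in> Lp_fun cs p" and s0: "pint cs p s \<noteq> 0"
  obtains s' where "s' \<in> Lp_fun cs p" "pint cs p s' = 1" "pint M p (S s') = pint M p (S s) / pint cs p s"
proof -
  have pos: "0 < pint cs p s" using s0 pint_nonneg[of cs p s] by linarith
  define c :: 'k where "c = of_real (pint cs p s powr (- 1 / p))"
  have c: "norm c powr p = 1 / pint cs p s"
  proof -
    have "norm c = pint cs p s powr (- 1 / p)" unfolding c_def norm_of_real by simp
    then have "norm c powr p = pint cs p s powr (- 1 / p * p)" by (simp only: powr_powr)
    also have "- 1 / p * p = - 1" using p by simp
    finally show ?thesis using pos by (simp add: powr_minus_divide)
  qed
  have sc: "(\<lambda>i. c * s i) \<in> Lp_fun cs p" by (rule Lp_fun_scale[OF s])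
  show ?thesis
  proof (rule that[OF sc])
    show "pint cs p (\<lambda>i. c * s i) = 1" using pos by (simp add: pint_scale c)
    have "pint M p (S (\<lambda>i. c * s i)) = pint M p (\<lambda>t. c * S s t)"
      using S_scale[OF s] Lp_fun_measurable[OF S_Lp[OF sc]] Lp_fun_measurable[OF S_Lp[OF s]]
      by (intro pint_cong_AE) auto
    then show "pint M p (S (\<lambda>i. c * s i)) = pint M p (S s) / pint cs p s"
      by (simp add: pint_scale c)
  qed
qed

lemma sphere_lp_space:
  fixes p :: real
  assumes "0 < p"
  shows "sphere_of (lp_space p) = {x :: nat \<Rightarrow> 'k::{real_normed_field,euclidean_space}. x \<in> Lp_fun cs p \<and> pint cs p x = 1}"
proof -
  have "a powr (1 / p) = 1 \<longleftrightarrow> a = 1" if "0 \<le> a" for a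
  proof
    assume "a powr (1 / p) = 1"
    then have "(a powr (1 / p)) powr p = 1" by simp
    then show "a = 1" using that assms by (simp add: powr_powr)
  qed simp
  then show ?thesis
    by (auto simp: sphere_of_def carrier_lp_space vnorm_lp_space pint_nonneg)
qed

text \<open>Evaluation at a coordinate is a bounded functional of norm at most 1.\<close>

lemma weakly_null_coordinate:
  fixes x :: "nat \<Rightarrow> nat \<Rightarrow> 'k::{real_normed_field,euclidean_space}"
  assumes p: "0 < p" and x: "weakly_null (lp_space p) x"
  shows "(\<lambda>n. x n i) \<longlonglongrightarrow> 0"
proof -
  have "norm (y i) \<le> vnorm (lp_space p) y" if "y \<in> Lp_fun cs p" for y :: "nat \<Rightarrow> 'k"
    using norm_coordinate_le(2)[OF p that order_refl] by (simp add: vnorm_lp_space that)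
  then have "(\<lambda>y. y i) \<in> bounded_ops (lp_space p) (scalar_sp :: ('k, 'k) normed_sp)"
    by (auto simp: bounded_ops_def scalar_sp_def vadd_lp_space vscale_lp_space carrier_lp_space
        intro!: exI[of _ 1])
  then show ?thesis using x by (auto simp: weakly_null_def)
qed

section \<open>The two properties of the pair\<close>

context
  fixes M :: "'a measure" and p :: real
    and T :: "(nat \<Rightarrow> 'k::{real_normed_field,euclidean_space}) \<Rightarrow> ('a \<Rightarrow> 'k) set"
  assumes M: "finite_measure M" and p: "2 \<le> p"
    and T: "T \<in> bounded_ops (lp_space p) (Lp_space M p)"
begin

lemma operator_carrier:
  assumes "x \<in> Lp_fun cs p"
  shows "T x \<in> carrier (Lp_space M p)"
  using bounded_opsD(1)[OF T] assms unfolding carrier_lp_space .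

text \<open>Homogeneity carries the bound from the sphere to all of l_p. The number \<open>m\<close>
  is left free so that it can be 1 for property (m) and the minimum modulus itself for
  attainment.\<close>

lemma min_modulus_le:
  assumes x: "x \<in> Lp_fun cs p" and m: "0 \<le> m" "m \<le> min_modulus (lp_space p) (Lp_space M p) T"
  shows "m powr p * pint cs p x \<le> pint M p (Lp_rep (T x))"
proof (cases "pint cs p x = 0")
  case True
  then show ?thesis by (simp add: pint_nonneg)
next
  case False
  have p0: "0 < p" using p by simp
  obtain C where "Lp_operator M p (\<lambda>x. Lp_rep (T x)) C"
    using bounded_ops_Lp_operator[OF M p T] .
  from Lp_operator.normalized[OF this x False] obtain s where s: "s \<in> Lp_fun cs p" "pint cs p s = 1"
    "pint M p (Lp_rep (T s)) = pint M p (Lp_rep (T x)) / pint cs p x" .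
  have "s \<in> sphere_of (lp_space p)" using s p0 by (simp add: sphere_lp_space)
  \<comment> \<open>An infimum of reals is a lower bound only for sets bounded below; norms are
    nonnegative.\<close>
  moreover have "bdd_below ((\<lambda>x. vnorm (Lp_space M p) (T x)) ` sphere_of (lp_space p))"
    using p0 by (intro bdd_belowI2[of _ 0]) (auto simp: sphere_lp_space vnorm_Lp_space operator_carrier)
  ultimately have "min_modulus (lp_space p) (Lp_space M p) T \<le> vnorm (Lp_space M p) (T s)"
    unfolding min_modulus_def by (intro cINF_lower)
  then have "m \<le> pint M p (Lp_rep (T s)) powr (1 / p)"
    using m by (simp add: vnorm_Lp_space operator_carrier s(1))
  then have "m powr p \<le> pint M p (Lp_rep (T x)) / pint cs p x"
    using p0 m s(3) by (simp add: powr_root_le_iff pint_nonneg)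
  then show ?thesis
    using False pint_nonneg[of cs p x] by (simp add: field_simps)
qed

lemma op_property_m_lp_Lp:
  assumes "1 \<le> min_modulus (lp_space p) (Lp_space M p) T"
  shows "op_property_m (lp_space p) (Lp_space M p) T"
  unfolding op_property_m_def
proof (intro ballI impI allI)
  fix s :: "nat \<Rightarrow> 'k" and y :: "('a \<Rightarrow> 'k) set" and x :: "nat \<Rightarrow> nat \<Rightarrow> 'k"
  assume s: "s \<in> carrier (lp_space p)" and y: "y \<in> carrier (Lp_space M p)"
    and sy: "vnorm (lp_space p) s \<le> vnorm (Lp_space M p) y" and xw: "weakly_null (lp_space p) x"
  have p0: "0 < p" "0 \<le> p" using p by auto
  have s: "s \<in> Lp_fun cs p" using s by (simp add: carrier_lp_space)
  have x: "x n \<in> Lp_fun cs p" for n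
    using xw by (simp add: weakly_null_def carrier_lp_space)
  obtain C where "Lp_operator M p (\<lambda>x. Lp_rep (T x)) C"
    using bounded_ops_Lp_operator[OF M p T] .
  then interpret Lp_operator M p "\<lambda>x. Lp_rep (T x)" C .
  have sy': "pint cs p s \<le> pint M p (Lp_rep y)"
  proof (rule ccontr)
    assume "\<not> pint cs p s \<le> pint M p (Lp_rep y)"
    then have "pint M p (Lp_rep y) powr (1 / p) < pint cs p s powr (1 / p)"
      using p0 by (intro powr_less_mono2) (auto simp: pint_nonneg)
    then show False using sy by (simp add: vnorm_lp_space[OF s] vnorm_Lp_space[OF y])
  qed
  let ?u = "\<lambda>n. vnorm (lp_space p) (vadd (lp_space p) s (x n))"
  let ?v = "\<lambda>n. vnorm (Lp_space M p) (vadd (Lp_space M p) y (T (x n)))"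
  have u: "?u n = pint cs p (\<lambda>i. s i + x n i) powr (1 / p)" for n
    using p0 by (simp add: vadd_lp_space vnorm_lp_space Lp_fun_add s x)
  have v: "?v n = pint M p (\<lambda>t. Lp_rep y t + Lp_rep (T (x n)) t) powr (1 / p)" for n
  proof -
    note c = AE_Lp_rep_vadd[OF y operator_carrier[OF x, of n] p0(2)]
    have "pint M p (Lp_rep (vadd (Lp_space M p) y (T (x n)))) = pint M p (\<lambda>t. Lp_rep y t + Lp_rep (T (x n)) t)"
      by (intro pint_cong_AE c(2) Lp_fun_measurable[where p = p] Lp_fun_add Lp_rep(1) c(1) y operator_carrier x p0)
    then show ?thesis by (simp add: vnorm_Lp_space c(1))
  qed
  show "limsup (\<lambda>n. ereal (?u n)) \<le> limsup (\<lambda>n. ereal (?v n))"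
    unfolding Limsup_le_iff
  proof (intro allI impI)
    fix b :: ereal assume "limsup (\<lambda>n. ereal (?v n)) < b"
    \<comment> \<open>The bound \<open>b\<close> may be infinite, so a real \<open>L'\<close> is put
      below it; the second real \<open>L\<close> leaves the strict gap that
      \<open>eventually_pint_less\<close> asks for.\<close>
    then obtain L' where L': "limsup (\<lambda>n. ereal (?v n)) < ereal L'" "ereal L' < b"
      using ereal_dense2 by blast
    then obtain L where L: "limsup (\<lambda>n. ereal (?v n)) < ereal L" "L < L'"
      using ereal_dense2 by force
    have ev: "\<forall>\<^sub>F n in sequentially. ?v n < L"
      using Limsup_lessD[OF L(1)] by simp
    then have "\<exists>n. ?v n < L" by (rule eventually_happens'[OF trivial_limit_sequentially])
    then obtain n where "?v n < L" by blast
    moreover have "0 \<le> ?v n" unfolding v by simp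
    ultimately have L0: "0 \<le> L" by linarith
    have "\<forall>\<^sub>F n in sequentially. pint M p (\<lambda>t. Lp_rep y t + Lp_rep (T (x n)) t) \<le> L powr p"
      using ev
    proof eventually_elim
      case (elim n)
      then have "?v n \<le> L" by simp
      then show ?case
        unfolding v by (rule iffD1[OF powr_root_le_iff(1)[OF p0(1) pint_nonneg L0]])
    qed
    moreover have "L powr p < L' powr p"
      using L(2) L0 p0 by (intro powr_less_mono2) auto
    moreover have "pint cs p z \<le> pint M p (Lp_rep (T z))" if "z \<in> Lp_fun cs p" for z
      using min_modulus_le[OF that, of 1] assms by simp
    ultimately have "\<forall>\<^sub>F n in sequentially. pint cs p (\<lambda>i. s i + x n i) < L' powr p"
      by (intro eventually_pint_less[OF _ s Lp_rep(1)[OF y] sy' x weakly_null_coordinate[OF p0(1) xw]])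
    then show "\<forall>\<^sub>F n in sequentially. ereal (?u n) < b"
    proof eventually_elim
      case (elim n)
      have "?u n \<le> L'"
        unfolding u using elim L0 L(2)
        by (intro iffD2[OF powr_root_le_iff(1)[OF p0(1) pint_nonneg]]) auto
      then have "ereal (?u n) \<le> ereal L'" by simp
      also note L'(2)
      finally show ?case .
    qed
  qed
qed

lemma attains_min_modulus_lp_Lp:
  assumes x: "minimizing_seq (lp_space p) (Lp_space M p) T x" and nw: "\<not> weakly_null (lp_space p) x"
  shows "attains_min_modulus (lp_space p) (Lp_space M p) T"
proof -
  have p0: "0 < p" "0 \<le> p" using p by auto
  define m where "m = min_modulus (lp_space p) (Lp_space M p) T"
  have xs: "x n \<in> Lp_fun cs p" "pint cs p (x n) = 1" for n
    using x p0 by (auto simp: minimizing_seq_def sphere_lp_space)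
  have lim: "(\<lambda>n. pint M p (Lp_rep (T (x n))) powr (1 / p)) \<longlonglongrightarrow> m"
    using x by (simp add: minimizing_seq_def m_def vnorm_Lp_space operator_carrier xs)
  have m0: "0 \<le> m" by (rule LIMSEQ_le_const[OF lim]) auto
  have "(\<lambda>n. (pint M p (Lp_rep (T (x n))) powr (1 / p)) powr p) \<longlonglongrightarrow> m powr p"
    by (rule tendsto_powr2[OF lim tendsto_const]) (use p0 in auto)
  then have lim': "(\<lambda>n. pint M p (Lp_rep (T (x n)))) \<longlonglongrightarrow> m powr p"
    using p0 by (simp add: powr_powr pint_nonneg)
  have lower: "m powr p * pint cs p s \<le> pint M p (Lp_rep (T s))" if "s \<in> Lp_fun cs p" for s
    using min_modulus_le[OF that m0] by (simp add: m_def)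
  obtain f where f: "f \<in> bounded_ops (lp_space p) (scalar_sp :: ('k, 'k) normed_sp)" "\<not> (\<lambda>n. f (x n)) \<longlonglongrightarrow> 0"
    using nw xs by (auto simp: weakly_null_def carrier_lp_space)
  obtain D where D: "\<And>s. s \<in> Lp_fun cs p \<Longrightarrow> norm (f s) \<le> D * pint cs p s powr (1 / p)"
  proof -
    obtain D where "\<forall>s\<in>Lp_fun cs p. norm (f s) \<le> D * vnorm (lp_space p) s"
      using bounded_opsD(4)[OF f(1)] unfolding carrier_lp_space by (auto simp: scalar_sp_def)
    then show thesis by (intro that[of D]) (simp add: vnorm_lp_space)
  qed
  \<comment> \<open>\<open>additive_vanishes\<close> speaks of real-valued maps, so a real component
    of \<open>f\<close> that does not tend to 0 along the sequence is selected.\<close>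
  obtain b where b: "b \<in> Basis" "\<not> (\<lambda>n. f (x n) \<bullet> b) \<longlonglongrightarrow> 0"
    using f(2) by (subst (asm) tendsto_componentwise_iff) auto
  have add: "f (\<lambda>i. s i + v i) \<bullet> b = f s \<bullet> b + f v \<bullet> b"
    if "s \<in> Lp_fun cs p" "v \<in> Lp_fun cs p" for s v
  proof -
    have "f (\<lambda>i. s i + v i) = f s + f v"
      using bounded_opsD(2)[OF f(1)] that unfolding carrier_lp_space vadd_lp_space
      by (simp add: scalar_sp_def)
    then show ?thesis by (simp add: inner_add_left)
  qed
  have bound: "\<bar>f s \<bullet> b\<bar> \<le> \<bar>D\<bar> * (1 + pint cs p s) powr (1 / p)" if s: "s \<in> Lp_fun cs p" for s
  proof -
    have "\<bar>f s \<bullet> b\<bar> \<le> norm (f s)" by (rule Basis_le_norm[OF b(1)])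
    also have "\<dots> \<le> D * pint cs p s powr (1 / p)" by (rule D[OF s])
    also have "\<dots> \<le> \<bar>D\<bar> * (1 + pint cs p s) powr (1 / p)"
      using p0 pint_nonneg[of cs p s] by (intro mult_mono powr_mono2) auto
    finally show ?thesis .
  qed
  obtain C where "Lp_operator M p (\<lambda>x. Lp_rep (T x)) C"
    using bounded_ops_Lp_operator[OF M p T] .
  then interpret Lp_operator M p "\<lambda>x. Lp_rep (T x)" C .
  obtain s where s: "s \<in> Lp_fun cs p" "pint cs p s \<noteq> 0" "pint M p (Lp_rep (T s)) \<le> m powr p * pint cs p s"
    by (rule minimizer_of_minimizing_seq[OF xs lim' lower add bound b(2)])
  obtain z where z: "z \<in> Lp_fun cs p" "pint cs p z = 1"
    "pint M p (Lp_rep (T z)) = pint M p (Lp_rep (T s)) / pint cs p s"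
    using normalized[OF s(1,2)] .
  have "pint M p (Lp_rep (T z)) \<le> m powr p"
    using s(2,3) pint_nonneg[of cs p s] unfolding z(3) by (simp add: pos_divide_le_eq)
  moreover have "m powr p \<le> pint M p (Lp_rep (T z))"
    using lower[OF z(1)] z(2) by simp
  ultimately have "pint M p (Lp_rep (T z)) = m powr p" by simp
  then have "vnorm (Lp_space M p) (T z) = m"
    using m0 p0 by (simp add: vnorm_Lp_space operator_carrier z(1) powr_powr)
  then show ?thesis
    unfolding attains_min_modulus_def using z p0 by (auto simp: m_def sphere_lp_space)
qed

end

theorem lp_Lp_properties:
  assumes "finite_measure M" "2 \<le> p"
  shows "pair_property_m (lp_space p :: ('k::{real_normed_field,euclidean_space}, nat \<Rightarrow> 'k) normed_sp) (Lp_space M p)"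
    and "weak_minimizing_property (lp_space p :: ('k, nat \<Rightarrow> 'k) normed_sp) (Lp_space M p)"
  unfolding pair_property_m_def weak_minimizing_property_def
  by (intro ballI impI op_property_m_lp_Lp[OF assms], assumption+)
    (intro ballI impI, elim exE conjE, rule attains_min_modulus_lp_Lp[OF assms])

theorem mainTheorem2:
  fixes p :: real
  assumes "2 \<le> p"
  shows "pair_property_m (lp_space p :: (real, nat \<Rightarrow> real) normed_sp) (Lp01 p)
       \<and> weak_minimizing_property (lp_space p :: (real, nat \<Rightarrow> real) normed_sp) (Lp01 p)
       \<and> pair_property_m (lp_space p :: (complex, nat \<Rightarrow> complex) normed_sp) (Lp01 p)
       \<and> weak_minimizing_property (lp_space p :: (complex, nat \<Rightarrow> complex) normed_sp) (Lp01 p)"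
proof -
  have "finite_measure (lebesgue_on {0..1::real})"
    by (intro finite_measureI) (simp add: space_restrict_space emeasure_restrict_space)
  with assms show ?thesis by (intro conjI lp_Lp_properties)
qed

end
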